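(* Let $m\in\mathbb Z_{>1}$, $n\in\mathbb Z_{>0}$ and let $J_i^{(m)}=[(i-1)m+1,(i+1)m-1]$, $i\in\mathbb Z_{>0}$. (a) The assignments $T_i\mapsto T_{w_{J_i^{(m)}\setminus\{im\};J_i^{(m)}}}$, $i\in[1,n-1]$, define a Coxeter type homomorphism $\Phi_n^{(m)}:\mathrm{Br}^+_n\to\mathrm{Br}^+_{nm}$. (b) The assignments $T_i\mapsto T_{w_\circ^{J_i^{(m)}}}$, $i\in[1,n-1]$, define a standard homomorphism $\widehat\Phi_n^{(m)}:\mathrm{Br}^+_n\to\mathrm{Br}^+_{nm}$. Suppose moreover $n\ge2$ and let $\widehat M=B_n$, $\widetilde M=B_{mn}$, with generators $\widehat T_i$ of $\mathrm{Br}^+(\widehat M)$ and $\widetilde T_i$ of $\mathrm{Br}^+(\widetilde M)$. (c) The assignments $\widehat T_i\mapsto\widetilde T_{w_{J_i^{(m)}\setminus\{im\};J_i^{(m)}}}$, $i\in[1,n-1]$, $\widehat T_n\mapsto\widetilde T_{w_{[(n-1)m+1,nm-1];[(n-1)m+1,nm]}}$ define a Coxeter type homomorphism $\mathrm{Br}^+(\widehat M)\to\mathrm{Br}^+(\widetilde M)$. (d) The assignments $\widehat T_i\mapsto\widetilde T_{w_\circ^{J_i^{(m)}}}$, $i\in[1,n-1]$, $\widehat T_n\mapsto\widetilde T_{w_\circ^{[(n-1)m+1,nm]}}$ define a standard homomorphism $\mathrm{Br}^+(\widehat M)\to\mathrm{Br}^+(\widetilde M)$.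
   Context: For integers $a\le b$, $[a,b]=\{a,\dots,b\}$ ($[a,b]=\emptyset$ if $a>b$). For a Coxeter matrix $M=(m_{ij})_{i,j\in I}$, $\mathrm{Br}^+(M)$ is the Artin monoid with generators $T_i$, $i\in I$, and relations $T_iT_jT_i\cdots=T_jT_iT_j\cdots$ ($m_{ij}$ factors each) for $i\neq j$, $m_{ij}<\infty$; $W(M)$ is the Coxeter group with generators $s_i$, and $\pi_M:\mathrm{Br}^+(M)\to W(M)$, $T_i\mapsto s_i$. $\mathrm{Br}^+_k=\mathrm{Br}^+(A_{k-1})$ is the braid monoid on $k$ strands with generators $T_1,\dots,T_{k-1}$ labelled along the chain (it is trivial for $k=1$). $B_n$ ($n\ge2$) is over $[1,n]$ with $m_{i,i+1}=3$ for $i\le n-2$, $m_{n-1,n}=4$ and other off-diagonal entries $2$. For $w\in W(M)$ with reduced expression $s_{i_1}\cdots s_{i_k}$, $T_w=T_{i_1}\cdots T_{i_k}$ (and $\widetilde T_w$ denotes the same in $\mathrm{Br}^+(\widetilde M)$). $w_\circ^J$ denotes the longest element of the parabolic subgroup $\langle s_j:j\in J\rangle$ (when finite), and for $J\subset K$ one sets $w_{J;K}=w_\circ^Jw_\circ^K$. A homomorphism $\Phi:\mathrm{Br}^+(M_1)\to\mathrm{Br}^+(M_2)$ is standard if every generator is mapped to some $T_{w_\circ^J}$; it is of Coxeter type if there is a group homomorphism $\phi:W(M_1)\to W(M_2)$ with $\phi\circ\pi_{M_1}=\pi_{M_2}\circ\Phi$. *)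

theory Defs
  imports "HOL-Algebra.Generated_Groups" "HOL-Library.Extended_Nat"
begin

section \<open>Monoids given by generators and relations\<close>

inductive_set word_cong :: "'i set \<Rightarrow> ('i list \<times> 'i list) set \<Rightarrow> ('i list \<times> 'i list) set"
  for I :: "'i set" and R :: "('i list \<times> 'i list) set"
where
  rel: "\<lbrakk>(x, y) \<in> R; x \<in> lists I; y \<in> lists I; u \<in> lists I; v \<in> lists I\<rbrakk>
        \<Longrightarrow> (u @ x @ v, u @ y @ v) \<in> word_cong I R"
| refl: "u \<in> lists I \<Longrightarrow> (u, u) \<in> word_cong I R"
| sym: "(u, v) \<in> word_cong I R \<Longrightarrow> (v, u) \<in> word_cong I R"
| trans: "\<lbrakk>(u, v) \<in> word_cong I R; (v, w) \<in> word_cong I R\<rbrakk> \<Longrightarrow> (u, w) \<in> word_cong I R"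

definition presented_monoid :: "'i set \<Rightarrow> ('i list \<times> 'i list) set \<Rightarrow> 'i list set monoid" where
  "presented_monoid I R =
     \<lparr>carrier = lists I // word_cong I R,
      mult = (\<lambda>X Y. \<Union>u\<in>X. \<Union>v\<in>Y. word_cong I R `` {u @ v}),
      one = word_cong I R `` {[]}\<rparr>"

definition monoid_hom :: "('a, 'x) monoid_scheme \<Rightarrow> ('b, 'y) monoid_scheme \<Rightarrow> ('a \<Rightarrow> 'b) set" where
  "monoid_hom G H = {f \<in> hom G H. f \<one>\<^bsub>G\<^esub> = \<one>\<^bsub>H\<^esub>}"


section \<open>Coxeter matrices, Artin monoids and Coxeter groups\<close>

record 'i coxeter_data =
  nodes :: "'i set"
  entry :: "'i \<Rightarrow> 'i \<Rightarrow> enat"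

definition coxeter_matrix :: "'i coxeter_data \<Rightarrow> bool" where
  "coxeter_matrix M \<longleftrightarrow>
     (\<forall>i\<in>nodes M. entry M i i = 1) \<and>
     (\<forall>i\<in>nodes M. \<forall>j\<in>nodes M. entry M i j = entry M j i \<and> (i \<noteq> j \<longrightarrow> 2 \<le> entry M i j))"

primrec alternating :: "'i \<Rightarrow> 'i \<Rightarrow> nat \<Rightarrow> 'i list" where
  "alternating i j 0 = []"
| "alternating i j (Suc k) = i # alternating j i k"

definition braid_relations :: "'i coxeter_data \<Rightarrow> ('i list \<times> 'i list) set" where
  "braid_relations M =
     {(alternating i j k, alternating j i k) | i j k.
        i \<in> nodes M \<and> j \<in> nodes M \<and> i \<noteq> j \<and> entry M i j = enat k}"

text \<open>The relators \<open>(s\<^sub>i s\<^sub>j)\<^bsup>m\<^esup>\<close> with \<open>m = m\<^sub>i\<^sub>j\<close>. Since \<open>m\<^sub>i\<^sub>i = 1\<close>, these contain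
  \<open>s\<^sub>i s\<^sub>i = 1\<close>, so the monoid with this presentation is the group with this presentation
  (see \<open>group_Cox\<close> below).\<close>

definition coxeter_relations :: "'i coxeter_data \<Rightarrow> ('i list \<times> 'i list) set" where
  "coxeter_relations M =
     {(concat (replicate k [i, j]), []) | i j k.
        i \<in> nodes M \<and> j \<in> nodes M \<and> entry M i j = enat k}"

definition Artin :: "'i coxeter_data \<Rightarrow> 'i list set monoid" where
  "Artin M = presented_monoid (nodes M) (braid_relations M)"

definition Cox :: "'i coxeter_data \<Rightarrow> 'i list set monoid" where
  "Cox M = presented_monoid (nodes M) (coxeter_relations M)"

definition artin_class :: "'i coxeter_data \<Rightarrow> 'i list \<Rightarrow> 'i list set" where
  "artin_class M u = word_cong (nodes M) (braid_relations M) `` {u}"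

definition cox_class :: "'i coxeter_data \<Rightarrow> 'i list \<Rightarrow> 'i list set" where
  "cox_class M u = word_cong (nodes M) (coxeter_relations M) `` {u}"

definition artin_gen :: "'i coxeter_data \<Rightarrow> 'i \<Rightarrow> 'i list set" where
  "artin_gen M i = artin_class M [i]"

definition cox_gen :: "'i coxeter_data \<Rightarrow> 'i \<Rightarrow> 'i list set" where
  "cox_gen M i = cox_class M [i]"

text \<open>All words in the class \<open>X\<close> have the same image in the Coxeter group, so the union is over
  a single class (see \<open>artin_to_cox_class\<close>).\<close>

definition artin_to_cox :: "'i coxeter_data \<Rightarrow> 'i list set \<Rightarrow> 'i list set" where
  "artin_to_cox M X = (\<Union>u\<in>X. cox_class M u)"


section \<open>Length, reduced expressions and longest elements\<close>

definition cox_length :: "'i coxeter_data \<Rightarrow> 'i list set \<Rightarrow> nat" where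
  "cox_length M w = (LEAST k. \<exists>u\<in>lists (nodes M). cox_class M u = w \<and> length u = k)"

definition reduced_expression :: "'i coxeter_data \<Rightarrow> 'i list set \<Rightarrow> 'i list \<Rightarrow> bool" where
  "reduced_expression M w u \<longleftrightarrow>
     u \<in> lists (nodes M) \<and> cox_class M u = w \<and> length u = cox_length M w"

text \<open>The element \<open>T\<^sub>w\<close>; by Matsumoto's theorem it does not depend on the chosen reduced
  expression.\<close>

definition artin_lift :: "'i coxeter_data \<Rightarrow> 'i list set \<Rightarrow> 'i list set" where
  "artin_lift M w = artin_class M (SOME u. reduced_expression M w u)"

definition parabolic :: "'i coxeter_data \<Rightarrow> 'i set \<Rightarrow> 'i list set set" where
  "parabolic M J = generate (Cox M) (cox_gen M ` J)"

text \<open>Meaningful if \<open>parabolic M J\<close> is finite; the longest element is then unique.\<close>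

definition longest :: "'i coxeter_data \<Rightarrow> 'i set \<Rightarrow> 'i list set" where
  "longest M J = arg_max_on (cox_length M) (parabolic M J)"

text \<open>The element \<open>w\<^bsub>J;K\<^esub>\<close>.\<close>

definition relative_longest :: "'i coxeter_data \<Rightarrow> 'i set \<Rightarrow> 'i set \<Rightarrow> 'i list set" where
  "relative_longest M J K = longest M J \<otimes>\<^bsub>Cox M\<^esub> longest M K"


section \<open>Types of homomorphisms\<close>

definition standard_hom ::
    "'i coxeter_data \<Rightarrow> 'j coxeter_data \<Rightarrow> ('i list set \<Rightarrow> 'j list set) \<Rightarrow> bool" where
  "standard_hom M N \<Phi> \<longleftrightarrow>
     \<Phi> \<in> monoid_hom (Artin M) (Artin N) \<and>
     (\<forall>i\<in>nodes M. \<exists>J\<subseteq>nodes N. finite (parabolic N J) \<and>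
        \<Phi> (artin_gen M i) = artin_lift N (longest N J))"

definition coxeter_type_hom ::
    "'i coxeter_data \<Rightarrow> 'j coxeter_data \<Rightarrow> ('i list set \<Rightarrow> 'j list set) \<Rightarrow> bool" where
  "coxeter_type_hom M N \<Phi> \<longleftrightarrow>
     \<Phi> \<in> monoid_hom (Artin M) (Artin N) \<and>
     (\<exists>\<phi>\<in>hom (Cox M) (Cox N). \<forall>x\<in>carrier (Artin M).
        \<phi> (artin_to_cox M x) = artin_to_cox N (\<Phi> x))"


section \<open>Types A and B\<close>

definition type_A :: "nat \<Rightarrow> nat coxeter_data" where
  "type_A r = \<lparr>nodes = {1..r},
     entry = (\<lambda>i j. if i = j then 1 else if j = i + 1 \<or> i = j + 1 then 3 else 2)\<rparr>"

text \<open>Only used for \<open>n \<ge> 2\<close>.\<close>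

definition type_B :: "nat \<Rightarrow> nat coxeter_data" where
  "type_B n = \<lparr>nodes = {1..n},
     entry = (\<lambda>i j. if i = j then 1
                     else if {i, j} = {n - 1, n} then 4
                     else if j = i + 1 \<or> i = j + 1 then 3 else 2)\<rparr>"

text \<open>The Coxeter datum underlying the braid monoid on \<open>k \<ge> 1\<close> strands.\<close>

abbreviation strands :: "nat \<Rightarrow> nat coxeter_data" where
  "strands k \<equiv> type_A (k - 1)"

text \<open>The set \<open>J\<^sub>i\<close> for parameter \<open>m\<close>; natural number subtraction is exact for
  \<open>i \<ge> 1\<close> and \<open>m \<ge> 1\<close>.\<close>

definition block :: "nat \<Rightarrow> nat \<Rightarrow> nat set" where
  "block m i = {(i - 1) * m + 1 .. (i + 1) * m - 1}"


section \<open>Well-definedness\<close>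

lemma word_cong_lists: "(u, v) \<in> word_cong I R \<Longrightarrow> u \<in> lists I \<and> v \<in> lists I"
  by (induction rule: word_cong.induct) auto

lemma equiv_word_cong: "equiv (lists I) (word_cong I R)"
proof (rule equivI)
  show "word_cong I R \<subseteq> lists I \<times> lists I"
    using word_cong_lists by fast
  show "refl_on (lists I) (word_cong I R)"
    by (rule refl_onI) (rule word_cong.refl)
  show "sym (word_cong I R)"
    by (rule symI) (rule word_cong.sym)
  show "trans (word_cong I R)"
    by (rule transI) (rule word_cong.trans)
qed

lemma word_cong_context:
  assumes "(u, v) \<in> word_cong I R" "x \<in> lists I" "y \<in> lists I"
  shows "(x @ u @ y, x @ v @ y) \<in> word_cong I R"
  using assms
proof (induction rule: word_cong.induct)
  case (rel a b u v)
  then show ?case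
    using word_cong.rel[of a b R I "x @ u" "v @ y"] by simp
next
  case (refl u)
  then show ?case by (intro word_cong.refl) auto
next
  case (sym u v)
  then show ?case by (simp add: word_cong.sym)
next
  case (trans u v w)
  then show ?case by (auto intro: word_cong.trans[of "x @ u @ y"])
qed

lemma word_cong_append:
  assumes "(u, u') \<in> word_cong I R" "(v, v') \<in> word_cong I R"
  shows "(u @ v, u' @ v') \<in> word_cong I R"
proof (rule word_cong.trans)
  show "(u @ v, u' @ v) \<in> word_cong I R"
    using word_cong_context[OF assms(1), of "[]" v] word_cong_lists[OF assms(2)] by simp
  show "(u' @ v, u' @ v') \<in> word_cong I R"
    using word_cong_context[OF assms(2), of u' "[]"] word_cong_lists[OF assms(1)] by simp
qed

lemma mult_presented_monoid:
  assumes "u \<in> lists I" "v \<in> lists I"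
  shows "(word_cong I R `` {u}) \<otimes>\<^bsub>presented_monoid I R\<^esub> (word_cong I R `` {v})
           = word_cong I R `` {u @ v}"
proof -
  let ?U = "word_cong I R `` {u}" and ?V = "word_cong I R `` {v}"
  have same: "word_cong I R `` {a @ b} = word_cong I R `` {u @ v}" if "a \<in> ?U" "b \<in> ?V" for a b
  proof -
    have "(u @ v, a @ b) \<in> word_cong I R"
      using that by (intro word_cong_append) simp_all
    from equiv_class_eq[OF equiv_word_cong this] show ?thesis by (rule HOL.sym)
  qed
  have "u \<in> ?U" "v \<in> ?V"
    using word_cong.refl[OF assms(1)] word_cong.refl[OF assms(2)] by simp_all
  then have ne: "?U \<noteq> {}" "?V \<noteq> {}" by blast+
  have "(\<Union>a\<in>?U. \<Union>b\<in>?V. word_cong I R `` {a @ b}) = (\<Union>a\<in>?U. \<Union>b\<in>?V. word_cong I R `` {u @ v})"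
    by (intro SUP_cong HOL.refl same)
  also have "\<dots> = word_cong I R `` {u @ v}"
    using ne by (simp only: UN_constant if_False)
  finally show ?thesis
    by (simp only: presented_monoid_def monoid.simps)
qed

lemma carrier_presented_monoid:
  "carrier (presented_monoid I R) = (\<lambda>u. word_cong I R `` {u}) ` lists I"
  by (auto simp: presented_monoid_def quotient_def)

lemma one_presented_monoid: "\<one>\<^bsub>presented_monoid I R\<^esub> = word_cong I R `` {[]}"
  by (simp add: presented_monoid_def)

lemma monoid_presented_monoid: "monoid (presented_monoid I R)"
proof (rule monoidI)
  show "x \<otimes>\<^bsub>presented_monoid I R\<^esub> y \<in> carrier (presented_monoid I R)"
    if "x \<in> carrier (presented_monoid I R)" "y \<in> carrier (presented_monoid I R)" for x y
  proof -
    obtain a b where "a \<in> lists I" "b \<in> lists I"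
      "x = word_cong I R `` {a}" "y = word_cong I R `` {b}"
      using \<open>x \<in> _\<close> \<open>y \<in> _\<close> unfolding carrier_presented_monoid by blast
    moreover from this have "a @ b \<in> lists I" by simp
    ultimately show ?thesis
      unfolding carrier_presented_monoid by (simp only: mult_presented_monoid) (rule imageI)
  qed
next
  fix x y z
  assume "x \<in> carrier (presented_monoid I R)" "y \<in> carrier (presented_monoid I R)"
    "z \<in> carrier (presented_monoid I R)"
  then obtain a b c where *: "a \<in> lists I" "b \<in> lists I" "c \<in> lists I"
    and "x = word_cong I R `` {a}" "y = word_cong I R `` {b}" "z = word_cong I R `` {c}"
    unfolding carrier_presented_monoid by blast
  then show "x \<otimes>\<^bsub>presented_monoid I R\<^esub> y \<otimes>\<^bsub>presented_monoid I R\<^esub> z =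
      x \<otimes>\<^bsub>presented_monoid I R\<^esub> (y \<otimes>\<^bsub>presented_monoid I R\<^esub> z)"
    using mult_presented_monoid[of "a @ b" I c R] mult_presented_monoid[of a I "b @ c" R]
    by (simp add: mult_presented_monoid)
next
  show "\<one>\<^bsub>presented_monoid I R\<^esub> \<in> carrier (presented_monoid I R)"
    by (auto simp: carrier_presented_monoid one_presented_monoid)
next
  fix x
  assume "x \<in> carrier (presented_monoid I R)"
  then obtain a where *: "a \<in> lists I" "x = word_cong I R `` {a}"
    unfolding carrier_presented_monoid by blast
  then show "\<one>\<^bsub>presented_monoid I R\<^esub> \<otimes>\<^bsub>presented_monoid I R\<^esub> x = x"
    using mult_presented_monoid[of "[]" I a R] by (simp add: one_presented_monoid)
  show "x \<otimes>\<^bsub>presented_monoid I R\<^esub> \<one>\<^bsub>presented_monoid I R\<^esub> = x"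
    using * mult_presented_monoid[of a I "[]" R] by (simp add: one_presented_monoid)
qed

lemma monoid_Artin: "monoid (Artin M)"
  by (simp add: Artin_def monoid_presented_monoid)

lemma word_cong_cox_rev:
  assumes "coxeter_matrix M" "u \<in> lists (nodes M)"
  shows "(rev u @ u, []) \<in> word_cong (nodes M) (coxeter_relations M)"
  using assms(2)
proof (induction u)
  case Nil
  then show ?case by (auto intro: word_cong.refl)
next
  case (Cons i u)
  have "concat (replicate (Suc 0) [i, i]) = [i, i]" by simp
  moreover have "entry M i i = enat (Suc 0)"
    using assms(1) Cons by (auto simp: coxeter_matrix_def one_enat_def)
  ultimately have "([i, i], []) \<in> coxeter_relations M"
    unfolding coxeter_relations_def using Cons by force
  then have "(rev u @ [i, i] @ u, rev u @ [] @ u) \<in> word_cong (nodes M) (coxeter_relations M)"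
    using Cons by (intro word_cong.rel) auto
  moreover have "(rev u @ u, []) \<in> word_cong (nodes M) (coxeter_relations M)"
    using Cons by simp
  ultimately have "(rev u @ [i, i] @ u, []) \<in> word_cong (nodes M) (coxeter_relations M)"
    by (simp only: append_Nil) (rule word_cong.trans)
  then show ?case by simp
qed

lemma group_Cox:
  assumes "coxeter_matrix M"
  shows "group (Cox M)"
proof -
  interpret monoid "Cox M"
    by (simp add: Cox_def monoid_presented_monoid)
  show ?thesis
  proof (rule group_l_invI)
    fix x
    assume "x \<in> carrier (Cox M)"
    then obtain u where u: "u \<in> lists (nodes M)" "x = cox_class M u"
      by (auto simp: Cox_def cox_class_def carrier_presented_monoid)
    have v: "rev u \<in> lists (nodes M)" using u(1) by (simp add: in_lists_conv_set)
    have "cox_class M (rev u) \<otimes>\<^bsub>Cox M\<^esub> x = \<one>\<^bsub>Cox M\<^esub>"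
      using equiv_class_eq[OF equiv_word_cong word_cong_cox_rev[OF assms u(1)]]
      unfolding Cox_def cox_class_def u(2)
      by (simp only: mult_presented_monoid[OF v u(1)] one_presented_monoid)
    moreover have "cox_class M (rev u) \<in> carrier (Cox M)"
      using v by (auto simp: Cox_def cox_class_def carrier_presented_monoid)
    ultimately show "\<exists>y\<in>carrier (Cox M). y \<otimes>\<^bsub>Cox M\<^esub> x = \<one>\<^bsub>Cox M\<^esub>" by blast
  qed
qed

lemma alternating_cox:
  assumes "coxeter_matrix M" "i \<in> nodes M" "j \<in> nodes M" "entry M i j = enat k"
  shows "(alternating i j k, alternating j i k) \<in> word_cong (nodes M) (coxeter_relations M)"
proof -
  let ?R = "word_cong (nodes M) (coxeter_relations M)"
  have alt: "alternating a b l \<in> lists (nodes M)" if "a \<in> nodes M" "b \<in> nodes M" for a b l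
    using that by (induction l arbitrary: a b) auto
  have alt_append:
    "alternating a b (l + l') =
       alternating a b l @ (if even l then alternating a b l' else alternating b a l')"
    for a b :: 'a and l l'
    by (induction l arbitrary: a b) auto
  have rev_alt: "rev (alternating b a l) =
      (if even l then alternating a b l else alternating b a l)" for a b :: 'a and l
  proof (induction l arbitrary: a b)
    case (Suc l)
    show ?case
      using Suc[of b a] alt_append[of a b l 1] alt_append[of b a l 1] by auto
  qed simp
  have rep: "concat (replicate k [i, j]) = alternating i j (k + k)"
    by (induction k) auto
  have split: "alternating i j (k + k) = alternating i j k @ rev (alternating j i k)"
    by (simp add: alt_append rev_alt)
  have len: "alternating i j k \<in> lists (nodes M)" "alternating j i k \<in> lists (nodes M)"
    using alt assms by auto
  have "(alternating i j (k + k), []) \<in> coxeter_relations M"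
    unfolding coxeter_relations_def rep[symmetric] using assms by blast
  then have "([] @ alternating i j (k + k) @ alternating j i k, [] @ [] @ alternating j i k) \<in> ?R"
    using len alt assms by (intro word_cong.rel) auto
  then have 1: "(alternating i j k @ rev (alternating j i k) @ alternating j i k,
      alternating j i k) \<in> ?R"
    by (simp add: split)
  have "(alternating i j k @ (rev (alternating j i k) @ alternating j i k) @ [],
      alternating i j k @ [] @ []) \<in> ?R"
    using len by (intro word_cong_context word_cong_cox_rev assms) auto
  then have "(alternating i j k @ rev (alternating j i k) @ alternating j i k,
      alternating i j k) \<in> ?R"
    by simp
  from word_cong.trans[OF word_cong.sym[OF this] 1] show ?thesis .
qed

lemma artin_to_cox_class:
  assumes "coxeter_matrix M" "u \<in> lists (nodes M)"
  shows "artin_to_cox M (artin_class M u) = cox_class M u"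
proof -
  have "(x, y) \<in> word_cong (nodes M) (coxeter_relations M)"
    if "(x, y) \<in> word_cong (nodes M) (braid_relations M)" for x y
    using that
  proof (induction rule: word_cong.induct)
    case (rel x y u v)
    then show ?case
      using alternating_cox[OF assms(1)]
      by (auto simp: braid_relations_def intro!: word_cong_context)
  next
    case (refl u)
    then show ?case by (rule word_cong.refl)
  next
    case (sym u v)
    from sym.IH show ?case by (rule word_cong.sym)
  next
    case (trans u v w)
    from trans.IH show ?case by (rule word_cong.trans)
  qed
  then have same: "cox_class M v = cox_class M u" if "v \<in> artin_class M u" for v
    using that equiv_class_eq[OF equiv_word_cong, of u v]
    by (auto simp: cox_class_def artin_class_def)
  have "u \<in> artin_class M u"
    using assms by (auto simp: artin_class_def intro: word_cong.refl)
  then have ne: "artin_class M u \<noteq> {}" by blast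
  have "artin_to_cox M (artin_class M u) = (\<Union>v\<in>artin_class M u. cox_class M u)"
    unfolding artin_to_cox_def by (intro SUP_cong HOL.refl same)
  also have "\<dots> = cox_class M u"
    using ne by (simp only: UN_constant if_False)
  finally show ?thesis .
qed

lemma monoid_hom_Artin_unique:
  assumes "\<Phi> \<in> monoid_hom (Artin M) H" "\<Psi> \<in> monoid_hom (Artin M) H"
    and "\<And>i. i \<in> nodes M \<Longrightarrow> \<Phi> (artin_gen M i) = \<Psi> (artin_gen M i)"
    and "x \<in> carrier (Artin M)"
  shows "\<Phi> x = \<Psi> x"
proof -
  obtain u where u: "u \<in> lists (nodes M)" "x = artin_class M u"
    using assms(4) by (auto simp: Artin_def artin_class_def carrier_presented_monoid)
  have cl: "artin_class M v \<in> carrier (Artin M)" if "v \<in> lists (nodes M)" for v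
    using that by (auto simp: Artin_def artin_class_def carrier_presented_monoid)
  have "\<Phi> (artin_class M u) = \<Psi> (artin_class M u)"
    using u(1)
  proof (induction u)
    case Nil
    then show ?case
      using assms(1,2) by (simp add: monoid_hom_def Artin_def artin_class_def one_presented_monoid)
  next
    case (Cons i u)
    then have iu: "[i] \<in> lists (nodes M)" "u \<in> lists (nodes M)" "i \<in> nodes M" by auto
    have "artin_class M (i # u) = artin_class M [i] \<otimes>\<^bsub>Artin M\<^esub> artin_class M u"
      using mult_presented_monoid[OF iu(1,2)] by (simp add: Artin_def artin_class_def)
    moreover have "\<Phi> \<in> hom (Artin M) H" "\<Psi> \<in> hom (Artin M) H"
      using assms(1,2) by (simp_all add: monoid_hom_def)
    ultimately show ?case
      using assms(3)[OF iu(3)] Cons.IH cl[OF iu(1)] cl[OF iu(2)]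
      by (simp add: hom_mult[of _ "Artin M" H] artin_gen_def)
  qed
  then show ?thesis by (simp add: u)
qed

lemma coxeter_matrix_type_A: "coxeter_matrix (type_A r)"
  by (auto simp: coxeter_matrix_def type_A_def numeral_eq_enat)

lemma coxeter_matrix_type_B: "coxeter_matrix (type_B n)"
  by (auto simp: coxeter_matrix_def type_B_def numeral_eq_enat insert_commute)

end

theory Submission
  imports Defs "HOL-Combinatorics.Permutations"
begin

text \<open>
  Both types are treated at once inside type B: signed permutations are realised as permutations of
  the integers commuting with the mirror \<open>x \<mapsto> 2N + 1 - x\<close>, and the Coxeter group of type A is the
  subgroup generated by the nodes below \<open>N\<close>. A word is reduced iff every letter, read from the left,
  meets an ascent of the permutation built so far; an exchange argument and an analysis of the
  dihedral case give Matsumoto's theorem for such words.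

  Replacing each of the \<open>2n\<close> positions by a cable of \<open>m\<close> parallel strands turns a signed permutation
  of rank \<open>n\<close> into one of rank \<open>nm\<close>. The element \<open>w\<^bsub>J;K\<^esub>\<close> attached to the generator \<open>s\<close> is the cabling
  of \<open>s\<close>, and cabling takes ascents to ascents, so the two sides of a braid relation become reduced
  words of the same element: this gives (a) and (c). For (b) and (d), the longest element attached to
  \<open>s\<close> is the cabling of \<open>s\<close> times flips (half twists) of the cables involved. Flips commute with each other
  and slide through cabled crossings, so both sides of a braid relation become the same cabled word
  times a product of flips, and the multisets of flips agree.
\<close>

section \<open>Signed permutations\<close>

text \<open>Lengths and \<open>artin_lift\<close> are defined through the abstract presentation and
  a choice of reduced word, so little can be computed before the Coxeter group is known to act
  faithfully. Faithfulness is therefore derived from Matsumoto's theorem for ascending words, a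
  notion that refers to the action alone; that ascending means reduced comes afterwards. Placing the
  positions at 1, ..., 2N with the mirror centred between N and N + 1 replaces signs by plain order
  and is compatible with cables: strand r of cable q is mirrored to strand m + 1 - r of cable 2n + 1
  - q. Parts (b) and (d) cannot be treated like (a) and (c): the images of the two sides of a braid
  relation are in general no longer reduced, since a cable is flipped several times (for a bond of
  order 3, each of the three cables twice). Matsumoto's theorem then applies only to the single
  exchanges of a flip with a flip or with a band, and the rest is a count of flips.\<close>

text \<open>The generator \<open>i\<close> swaps the positions \<open>i\<close> and \<open>i + 1\<close> and their mirror images; for \<open>i = N\<close> the two
  swaps coincide.\<close>

definition gen :: "nat \<Rightarrow> nat \<Rightarrow> int \<Rightarrow> int" where
  "gen N i x =
     (if x = int i then int i + 1
      else if x = int i + 1 then int i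
      else if x = 2 * int N - int i then 2 * int N + 1 - int i
      else if x = 2 * int N + 1 - int i then 2 * int N - int i
      else x)"

primrec act :: "nat \<Rightarrow> nat list \<Rightarrow> int \<Rightarrow> int" where
  "act N [] x = x"
| "act N (i # u) x = gen N i (act N u x)"

text \<open>For \<open>f = act N v\<close> this says that the letters of \<open>u\<close>, appended one by one to \<open>v\<close>, always
  increase the length. The base point \<open>f\<close> need not be a group element; \<open>- act N v\<close> is used below to
  count down from a descent.\<close>

primrec ascending :: "nat \<Rightarrow> (int \<Rightarrow> int) \<Rightarrow> nat list \<Rightarrow> bool" where
  "ascending N f [] = True"
| "ascending N f (i # u) = (f (int i) < f (int i + 1) \<and> ascending N (\<lambda>x. f (gen N i x)) u)"

abbreviation ascending_word :: "nat \<Rightarrow> nat list \<Rightarrow> bool" where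
  "ascending_word N \<equiv> ascending N (\<lambda>x. x)"

text \<open>The constant \<open>c\<close> is left free, instead of being 2N + 1, so that the class
  contains the permutations \<open>act N u\<close> and is also closed under negation, which turns
  descents into ascents.\<close>

definition mirror_sym :: "nat \<Rightarrow> (int \<Rightarrow> int) \<Rightarrow> bool" where
  "mirror_sym N f \<longleftrightarrow> inj f \<and> (\<exists>c. \<forall>x. f x + f (2 * int N + 1 - x) = c)"

lemma gen_left [simp]: "gen N i (int i) = int i + 1"
  by (simp add: gen_def)

lemma gen_right [simp]: "gen N i (int i + 1) = int i"
  by (simp add: gen_def)

lemma gen_mirror_left [simp]: "i \<le> N \<Longrightarrow> gen N i (2 * int N - int i) = 2 * int N + 1 - int i"
  by (simp add: gen_def)

lemma gen_mirror_right [simp]: "i \<le> N \<Longrightarrow> gen N i (2 * int N + 1 - int i) = 2 * int N - int i"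
  by (simp add: gen_def)

lemma gen_fixed:
  "x \<notin> {int i, int i + 1, 2 * int N - int i, 2 * int N + 1 - int i} \<Longrightarrow> gen N i x = x"
  by (simp add: gen_def)

lemma gen_gen: "i \<le> N \<Longrightarrow> gen N i (gen N i x) = x"
  by (cases "x \<in> {int i, int i + 1, 2 * int N - int i, 2 * int N + 1 - int i}")
    (auto simp: gen_fixed)

lemma gen_mirror:
  assumes "i \<le> N"
  shows "gen N i (2 * int N + 1 - x) = 2 * int N + 1 - gen N i x"
proof (cases "x \<in> {int i, int i + 1, 2 * int N - int i, 2 * int N + 1 - int i}")
  case True
  have d: "2 * int N + 1 - (int i + 1) = 2 * int N - int i"
    "2 * int N + 1 - (2 * int N - int i) = int i + 1"
    "2 * int N + 1 - (2 * int N + 1 - int i) = int i" by simp_all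
  from True show ?thesis
    by (auto simp only: insert_iff empty_iff d gen_left gen_right
        gen_mirror_left[OF assms] gen_mirror_right[OF assms])
next
  case False
  then have "2 * int N + 1 - x \<notin> {int i, int i + 1, 2 * int N - int i, 2 * int N + 1 - int i}"
    by auto
  then have "gen N i (2 * int N + 1 - x) = 2 * int N + 1 - x" by (rule gen_fixed)
  moreover from False have "gen N i x = x" by (rule gen_fixed)
  ultimately show ?thesis by simp
qed

lemma gen_cases:
  assumes "i \<le> N"
  obtains "x = int i" "gen N i x = int i + 1" | "x = int i + 1" "gen N i x = int i"
  | "x = 2 * int N - int i" "gen N i x = 2 * int N + 1 - int i"
  | "x = 2 * int N + 1 - int i" "gen N i x = 2 * int N - int i"
  | "gen N i x = x"
proof -
  consider "x = int i" | "x = int i + 1" | "x = 2 * int N - int i" | "x = 2 * int N + 1 - int i"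
    | "x \<notin> {int i, int i + 1, 2 * int N - int i, 2 * int N + 1 - int i}"
    by blast
  then show thesis
    by cases (use that gen_fixed[of x i N] gen_mirror_left[OF assms] gen_mirror_right[OF assms]
      gen_left gen_right in metis)+
qed

lemma gen_dist: "i \<le> N \<Longrightarrow> \<bar>gen N i x - x\<bar> \<le> 1"
  by (erule gen_cases[of i N x]) linarith+

lemma gen_up: "i \<le> N \<Longrightarrow> gen N i x = x + 1 \<Longrightarrow> x = int i \<or> x = 2 * int N - int i"
  by (erule gen_cases[of i N x]) linarith+

text \<open>\<open>gen N i\<close> moves every integer by at most 1, so only neighbours that it
  swaps can change their order.\<close>

lemma gen_reverses:
  assumes "i \<le> N" "a < b" "gen N i b < gen N i a"
  shows "a = int i \<and> b = int i + 1 \<or> a = 2 * int N - int i \<and> b = 2 * int N + 1 - int i"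
proof -
  have "b = a + 1" "gen N i a = a + 1"
    using assms gen_dist[of i N a] gen_dist[of i N b] by linarith+
  then show ?thesis using gen_up[of i N a] assms(1) by auto
qed

lemma inj_gen: "i \<le> N \<Longrightarrow> inj (gen N i)"
  by (metis gen_gen injI)

lemma mirror_sym_id: "mirror_sym N (\<lambda>x. x)"
  by (auto simp: mirror_sym_def)

lemma mirror_sym_gen: "mirror_sym N f \<Longrightarrow> i \<le> N \<Longrightarrow> mirror_sym N (\<lambda>x. f (gen N i x))"
  using inj_compose[OF _ inj_gen[of i N], of f]
  by (auto simp: mirror_sym_def gen_mirror comp_def)

lemma mirror_sym_uminus: "mirror_sym N f \<Longrightarrow> mirror_sym N (\<lambda>x. - f x)"
proof -
  assume "mirror_sym N f"
  then obtain c where "inj f" "\<And>x. f x + f (2 * int N + 1 - x) = c"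
    by (auto simp: mirror_sym_def)
  moreover have "- f x + - f (2 * int N + 1 - x) = - c" for x
    using calculation(2)[of x] by simp
  ultimately show "mirror_sym N (\<lambda>x. - f x)"
    unfolding mirror_sym_def by (auto simp: inj_def)
qed

lemma mirror_sym_step:
  assumes "mirror_sym N f"
  shows "f (2 * int N + 1 - x) - f (2 * int N + 1 - y) = f y - f x"
proof -
  obtain c where "\<And>x. f x + f (2 * int N + 1 - x) = c"
    using assms by (auto simp: mirror_sym_def)
  from this[of x] this[of y] show ?thesis by simp
qed

section \<open>Words acting as permutations\<close>

lemma act_append: "act N (u @ v) x = act N u (act N v x)"
  by (induction u) auto

lemma ascending_append:
  "ascending N f (u @ v) \<longleftrightarrow> ascending N f u \<and> ascending N (\<lambda>x. f (act N u x)) v"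
  by (induction u arbitrary: f) auto

lemma act_mirror: "u \<in> lists {..N} \<Longrightarrow> act N u (2 * int N + 1 - x) = 2 * int N + 1 - act N u x"
  by (induction u rule: list.induct) (auto simp: gen_mirror)

lemma act_rev: "u \<in> lists {..N} \<Longrightarrow> act N (rev u) (act N u x) = x"
  by (induction u arbitrary: x rule: list.induct) (auto simp: gen_gen act_append)

lemma act_rev': "u \<in> lists {..N} \<Longrightarrow> act N u (act N (rev u) x) = x"
  using act_rev[of "rev u" N x] by (simp add: in_lists_conv_set)

lemma inj_act: "u \<in> lists {..N} \<Longrightarrow> inj (act N u)"
  by (metis act_rev injI)

lemma mirror_sym_act:
  "mirror_sym N f \<Longrightarrow> u \<in> lists {..N} \<Longrightarrow> mirror_sym N (\<lambda>x. f (act N u x))"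
  using inj_compose[OF _ inj_act[of u N], of f]
  by (auto simp: mirror_sym_def act_mirror comp_def)

lemma mirror_sym_act_id: "u \<in> lists {..N} \<Longrightarrow> mirror_sym N (act N u)"
  using mirror_sym_act[OF mirror_sym_id] .

lemma mirror_sym_neq: "mirror_sym N f \<Longrightarrow> x \<noteq> y \<Longrightarrow> f x \<noteq> f y"
  by (auto simp: mirror_sym_def inj_def)

text \<open>Conjugating a pair of mirror swaps by a mirror-symmetric permutation gives the swaps of
  the image pairs. The exchange argument and the braid relations are all obtained from this.\<close>

lemma gen_conj:
  assumes "i \<le> N" "j \<le> N" "u \<in> lists {..N}"
    and "act N u (int i) = int j \<and> act N u (int i + 1) = int j + 1 \<or>
         act N u (int i) = 2 * int N - int j \<and> act N u (int i + 1) = 2 * int N + 1 - int j"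
  shows "gen N j (act N u x) = act N u (gen N i x)"
proof -
  let ?f = "act N u"
  have m1: "?f (2 * int N + 1 - int i) = 2 * int N + 1 - ?f (int i)"
    using act_mirror[OF assms(3), of "int i"] .
  have m2: "?f (2 * int N - int i) = 2 * int N + 1 - ?f (int i + 1)"
    using act_mirror[OF assms(3), of "int i + 1"] by simp
  have e: "?f x = ?f y \<longleftrightarrow> x = y" for y
    using inj_act[OF assms(3)] by (auto simp: inj_def)
  have n: "?f x \<notin> {?f (int i), ?f (int i + 1), ?f (2 * int N - int i), ?f (2 * int N + 1 - int i)}"
    if "x \<notin> {int i, int i + 1, 2 * int N - int i, 2 * int N + 1 - int i}"
    using that by (simp add: e)
  show ?thesis
  proof (cases "x \<in> {int i, int i + 1, 2 * int N - int i, 2 * int N + 1 - int i}")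
    case True
    then consider "x = int i" | "x = int i + 1" | "x = 2 * int N - int i" | "x = 2 * int N + 1 - int i"
      by blast
    then show ?thesis
    proof cases
      case 1
      then show ?thesis using assms(2,4) by (elim disjE) simp_all
    next
      case 2
      then show ?thesis using assms(2,4) by (elim disjE) simp_all
    next
      case 3
      then show ?thesis using assms(1,2,4) m1 m2 by (elim disjE) (simp_all add: add.commute[of 1])
    next
      case 4
      then show ?thesis using assms(1,2,4) m1 m2 by (elim disjE) (simp_all add: add.commute[of 1])
    qed
  next
    case False
    then have "gen N i x = x" by (rule gen_fixed)
    moreover have "gen N j (?f x) = ?f x"
      using n[OF False] assms(4) unfolding m1 m2 by (intro gen_fixed) auto
    ultimately show ?thesis by simp
  qed
qed

text \<open>The descent at \<open>i\<close> is created by some letter \<open>j\<close>, and at that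
  moment the values at \<open>i\<close> and \<open>i + 1\<close> are swapped by
  \<open>gen N j\<close>. By \<open>gen_conj\<close> this letter can be moved to the right end,
  where it becomes \<open>i\<close>; so deleting it amounts to multiplying by \<open>i\<close> on
  the right.\<close>

lemma exchange:
  assumes "u \<in> lists J" "J \<subseteq> {..N}" "i \<le> N" "act N u (int i + 1) < act N u (int i)"
  shows "\<exists>v\<in>lists J. Suc (length v) = length u \<and> (\<forall>x. act N v x = act N u (gen N i x))"
  using assms(1,4)
proof (induction u rule: list.induct)
  case Nil
  then show ?case by simp
next
  case (Cons j u)
  have u: "u \<in> lists J" "u \<in> lists {..N}" "j \<in> J" "j \<le> N" using Cons.prems(1) assms(2) by auto
  show ?case
  proof (cases "act N u (int i + 1) < act N u (int i)")
    case True
    then obtain v where "v \<in> lists J" "Suc (length v) = length u"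
      "\<forall>x. act N v x = act N u (gen N i x)"
      using Cons.IH[OF u(1)] by blast
    then show ?thesis using u(3) by (intro bexI[of _ "j # v"]) simp_all
  next
    case False
    then have lt: "act N u (int i) < act N u (int i + 1)"
      using mirror_sym_neq[OF mirror_sym_act_id[OF u(2)], of "int i" "int i + 1"] by simp
    have "gen N j (act N u (int i + 1)) < gen N j (act N u (int i))" using Cons.prems(2) by simp
    note gen_conj[OF assms(3) u(4) u(2) gen_reverses[OF u(4) lt this]]
    then have "act N (j # u) (gen N i x) = act N u x" for x
      by (simp add: gen_gen[OF assms(3)])
    then show ?thesis using u(1) by (intro bexI[of _ u]) (simp_all del: act.simps)
  qed
qed

text \<open>At the first letter that meets a descent, \<open>exchange\<close> shortens the prefix up
  to this letter. The new letters stay in \<open>J\<close>, which later allows lengths in a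
  parabolic subgroup to be compared with lengths in the whole group.\<close>

lemma ascending_or_shorter:
  assumes "J \<subseteq> {..N}" "u \<in> lists J"
  shows "ascending_word N u \<or> (\<exists>v\<in>lists J. length v < length u \<and> act N v = act N u)"
  using assms(2)
proof (induction u rule: rev_induct)
  case Nil
  then show ?case by simp
next
  case (snoc i u)
  then have u: "u \<in> lists J" "i \<in> J" "i \<le> N" "u \<in> lists {..N}" using assms(1) by auto
  show ?case
  proof (cases "ascending_word N u")
    case True
    show ?thesis
    proof (cases "act N u (int i) < act N u (int i + 1)")
      case True
      then show ?thesis using \<open>ascending_word N u\<close> by (simp add: ascending_append)
    next
      case False
      then have "act N u (int i + 1) < act N u (int i)"
        using mirror_sym_neq[OF mirror_sym_act_id[OF u(4)], of "int i" "int i + 1"] by simp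
      from exchange[OF u(1) assms(1) u(3) this] obtain v where v: "v \<in> lists J"
        "Suc (length v) = length u" "\<forall>x. act N v x = act N u (gen N i x)" by blast
      have "act N v = act N (u @ [i])"
        using v(3) by (intro ext) (simp add: act_append)
      then show ?thesis using v by (intro disjI2 bexI[of _ v]) auto
    qed
  next
    case False
    with snoc u obtain v where v: "v \<in> lists J" "length v < length u" "act N v = act N u" by auto
    have "act N (v @ [i]) = act N (u @ [i])"
      using v(3) by (intro ext) (simp add: act_append)
    then show ?thesis using v u by (intro disjI2 bexI[of _ "v @ [i]"]) auto
  qed
qed

lemma ascending_word_exists:
  assumes "J \<subseteq> {..N}" "u \<in> lists J"
  obtains v where "v \<in> lists J" "ascending_word N v" "act N v = act N u" "length v \<le> length u"
proof -
  have "\<exists>v\<in>lists J. ascending_word N v \<and> act N v = act N u \<and> length v \<le> length u"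
    using assms(2)
  proof (induction "length u" arbitrary: u rule: less_induct)
    case less
    show ?case
    proof (cases "ascending_word N u")
      case False
      then obtain v where v: "v \<in> lists J" "length v < length u" "act N v = act N u"
        using ascending_or_shorter[OF assms(1) less.prems] by auto
      from less.hyps[OF v(2,1)] show ?thesis using v by force
    qed (use less.prems in auto)
  qed
  then show ?thesis using that by auto
qed

text \<open>Each letter of \<open>u\<close> lowers \<open>f\<close>, so undoing the letters in the
  opposite order raises it at every step.\<close>

lemma ascending_rev:
  assumes "u \<in> lists {..N}" "ascending N (\<lambda>x. - f x) u"
  shows "ascending N (\<lambda>x. f (act N u x)) (rev u)"
  using assms
proof (induction u arbitrary: f rule: list.induct)
  case Nil
  then show ?case by simp
next
  case (Cons i u)
  then have i: "i \<le> N" "u \<in> lists {..N}" by auto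
  have "ascending N (\<lambda>x. f (gen N i (act N u x))) (rev u)"
    using Cons.IH[OF i(2), of "\<lambda>x. f (gen N i x)"] Cons.prems(2) by simp
  moreover have "f (int i + 1) < f (int i)" using Cons.prems by simp
  ultimately show ?case using i by (simp add: ascending_append act_rev')
qed

section \<open>Braid relations and the dihedral case\<close>

lemma length_alternating [simp]: "length (alternating i j k) = k"
  by (induction k arbitrary: i j) auto

lemma set_alternating: "set (alternating i j k) \<subseteq> {i, j}"
proof (induction k arbitrary: i j)
  case (Suc k)
  from Suc[of j i] show ?case by auto
qed simp

lemma type_B_entry_cases:
  assumes "i \<in> {1..N}" "j \<in> {1..N}" "i \<noteq> j"
  obtains "entry (type_B N) i j = enat 4" "i = N" "Suc j = N"
  | "entry (type_B N) i j = enat 4" "j = N" "Suc i = N"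
  | "entry (type_B N) i j = enat 3" "i = Suc j" "i < N"
  | "entry (type_B N) i j = enat 3" "j = Suc i" "j < N"
  | "entry (type_B N) i j = enat 2" "j + 1 < i"
  | "entry (type_B N) i j = enat 2" "i + 1 < j"
proof -
  consider "j + 1 < i" | "i + 1 < j" | "i = Suc j" | "j = Suc i" using assms by linarith
  then show thesis
  proof cases
    case 1
    then show ?thesis using assms by (intro that(5)) (auto simp: type_B_def doubleton_eq_iff numeral_eq_enat)
  next
    case 2
    then show ?thesis using assms by (intro that(6)) (auto simp: type_B_def doubleton_eq_iff numeral_eq_enat)
  next
    case 3
    show ?thesis
    proof (cases "i = N")
      case True
      then show ?thesis using assms 3 by (intro that(1)) (auto simp: type_B_def doubleton_eq_iff numeral_eq_enat)
    next
      case False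
      then show ?thesis using assms 3 by (intro that(3)) (auto simp: type_B_def doubleton_eq_iff numeral_eq_enat)
    qed
  next
    case 4
    show ?thesis
    proof (cases "j = N")
      case True
      then show ?thesis using assms 4 by (intro that(2)) (auto simp: type_B_def doubleton_eq_iff numeral_eq_enat)
    next
      case False
      then show ?thesis using assms 4 by (intro that(4)) (auto simp: type_B_def doubleton_eq_iff numeral_eq_enat)
    qed
  qed
qed

lemma gen_commute:
  assumes "i + 1 < j" "j \<le> N"
  shows "gen N i (gen N j x) = gen N j (gen N i x)"
proof -
  have "gen N i (int j) = int j" "gen N i (int j + 1) = int j + 1"
    using assms by (simp_all add: gen_def)
  then show ?thesis using gen_conj[of j N j "[i]" x] assms by simp
qed

text \<open>The word \<open>[i, Suc i]\<close> carries the pair (i, i + 1) to (i + 1, i + 2), hence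
  conjugates one generator into the other.\<close>

lemma gen_braid3:
  assumes "Suc i < N"
  shows "gen N i (gen N (Suc i) (gen N i x)) = gen N (Suc i) (gen N i (gen N (Suc i) x))"
proof -
  have "act N [i, Suc i] (int i) = int (Suc i)" "act N [i, Suc i] (int i + 1) = int (Suc i) + 1"
    using assms by (auto simp: gen_def)
  then show ?thesis using gen_conj[of i N "Suc i" "[i, Suc i]" x] assms by simp
qed

text \<open>The word \<open>[i, Suc i, i]\<close> fixes both middle positions, hence commutes with
  the central generator \<open>Suc i\<close>.\<close>

lemma gen_braid4:
  "gen (Suc i) i (gen (Suc i) (Suc i) (gen (Suc i) i (gen (Suc i) (Suc i) x))) =
   gen (Suc i) (Suc i) (gen (Suc i) i (gen (Suc i) (Suc i) (gen (Suc i) i x)))"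
proof -
  let ?u = "[i, Suc i, i]"
  have "act (Suc i) ?u (int (Suc i)) = int (Suc i)"
    "act (Suc i) ?u (int (Suc i) + 1) = int (Suc i) + 1"
    by (auto simp: gen_def)
  then show ?thesis using gen_conj[of "Suc i" "Suc i" "Suc i" ?u x] by simp
qed

lemma act_alternating:
  assumes "i \<in> {1..N}" "j \<in> {1..N}" "i \<noteq> j" "entry (type_B N) i j = enat k"
  shows "act N (alternating i j k) x = act N (alternating j i k) x"
  using assms(1-3)
proof (cases rule: type_B_entry_cases)
  case 1
  then show ?thesis using assms(4) gen_braid4[of j x] by (auto simp: numeral_eq_Suc)
next
  case 2
  then show ?thesis using assms(4) gen_braid4[of i x] by (auto simp: numeral_eq_Suc)
next
  case 3
  then show ?thesis using assms(4) gen_braid3[of j N x] by (auto simp: numeral_eq_Suc)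
next
  case 4
  then show ?thesis using assms(4) gen_braid3[of i N x] by (auto simp: numeral_eq_Suc)
next
  case 5
  then show ?thesis using assms gen_commute[of j i N x] by (auto simp: numeral_eq_Suc)
next
  case 6
  then show ?thesis using assms gen_commute[of i j N x] by (auto simp: numeral_eq_Suc)
qed

text \<open>The base point increases along each run of positions moved by the two generators, so
  every letter of an alternating word of length \<open>k\<close> still meets a pair in its original
  order. An arbitrary \<open>f\<close> is allowed because the lemma is applied to
  \<open>- act N u\<close> as well as to the identity.\<close>

lemma ascending_alternating:
  assumes "i \<in> {1..N}" "j \<in> {1..N}" "i \<noteq> j" "entry (type_B N) i j = enat k"
    and f: "mirror_sym N f" "f (int i) < f (int i + 1)" "f (int j) < f (int j + 1)"
  shows "ascending N f (alternating i j k)"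
proof -
  have c: "int x + 1 + 1 = int x + 2" "1 + int x = int x + 1" "1 + (int x + 1) = int x + 2"
    "2 + int x = int x + 2" for x by simp_all
  have B: "ascending N f (alternating i (Suc i) 4) \<and> ascending N f (alternating (Suc i) i 4)"
    if "N = Suc i" "f (int i) < f (int i + 1)" "f (int i + 1) < f (int i + 2)" for i
  proof -
    \<comment> \<open>Since \<open>N = Suc i\<close>, the mirror images of \<open>i\<close> and
      \<open>i + 1\<close> are \<open>i + 3\<close> and \<open>i + 2\<close>.\<close>
    have s: "f (int i + 2) < f (int i + 3)"
      using mirror_sym_step[OF f(1), of "int i" "int i + 1"] that by (simp add: algebra_simps)
    have "gen N i (int i) = int i + 1" "gen N i (int i + 1) = int i"
      "gen N (Suc i) (int i + 1) = int i + 2" "gen N (Suc i) (int i + 2) = int i + 1"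
      "gen N i (int i + 2) = int i + 3" "gen N i (int i + 3) = int i + 2"
      "gen N (Suc i) (int i) = int i" "gen N (Suc i) (int i + 3) = int i + 3"
      using that(1) by (simp_all add: gen_def)
    then show ?thesis using that(2,3) s by (simp add: numeral_eq_Suc c)
  qed
  have A: "ascending N f (alternating i (Suc i) 3) \<and> ascending N f (alternating (Suc i) i 3)"
    if "int i + 1 < int N" "f (int i) < f (int i + 1)" "f (int i + 1) < f (int i + 2)" for i
  proof -
    have "gen N i (int i) = int i + 1" "gen N i (int i + 1) = int i"
      "gen N (Suc i) (int i + 1) = int i + 2" "gen N (Suc i) (int i + 2) = int i + 1"
      "gen N i (int i + 2) = int i + 2" "gen N (Suc i) (int i) = int i"
      using that(1) by (simp_all add: gen_def)
    then show ?thesis using that(2,3) by (simp add: numeral_eq_Suc c)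
  qed
  have C: "ascending N f (alternating i j 2)"
    if "gen N i (int j) = int j" "gen N i (int j + 1) = int j + 1"
      "f (int i) < f (int i + 1)" "f (int j) < f (int j + 1)" for i j
    using that by (simp add: numeral_eq_Suc)
  have c: "int (Suc x) = int x + 1" "int x + 1 + 1 = int x + 2" for x by simp_all
  show ?thesis
    using assms(1-3)
  proof (cases rule: type_B_entry_cases)
    case 1
    then have k: "k = 4" "N = Suc j" "i = Suc j" using assms by auto
    from f(2,3) B[OF k(2)] show ?thesis unfolding k(1,3) c by simp
  next
    case 2
    then have k: "k = 4" "N = Suc i" "j = Suc i" using assms by auto
    from f(2,3) B[OF k(2)] show ?thesis unfolding k(1,3) c by simp
  next
    case 3
    then have k: "k = 3" "i = Suc j" "int j + 1 < int N" using assms by auto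
    from f(2,3) A[OF k(3)] show ?thesis unfolding k(1,2) c by simp
  next
    case 4
    then have k: "k = 3" "j = Suc i" "int i + 1 < int N" using assms by auto
    from f(2,3) A[OF k(3)] show ?thesis unfolding k(1,2) c by simp
  next
    case 5
    then have k: "k = 2" "int j + 1 < int i" "int i \<le> int N" using assms by auto
    then have "gen N i (int j) = int j" "gen N i (int j + 1) = int j + 1"
      by (simp_all add: gen_def)
    from C[OF this f(2,3)] show ?thesis using k(1) by simp
  next
    case 6
    then have k: "k = 2" "int i + 1 < int j" "int j \<le> int N" using assms by auto
    then have "gen N i (int j) = int j" "gen N i (int j + 1) = int j + 1"
      by (simp_all add: gen_def)
    from C[OF this f(2,3)] show ?thesis using k(1) by simp
  qed
qed

section \<open>Matsumoto's theorem and the word problem\<close>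

lemma braid_length: "(u, v) \<in> word_cong I (braid_relations M) \<Longrightarrow> length u = length v"
  by (induction rule: word_cong.induct) (auto simp: braid_relations_def)

text \<open>Covers both \<open>B\<^sub>N\<close> (with \<open>r = N\<close>) and \<open>A\<^bsub>N - 1\<^esub>\<close> (with \<open>r = N - 1\<close>).\<close>

locale sub_type_B =
  fixes M :: "nat coxeter_data" and N r :: nat
  assumes nodes_M: "nodes M = {1..r}"
    and r_le: "r \<le> N"
    and entry_M: "\<And>i j. i \<in> {1..r} \<Longrightarrow> j \<in> {1..r} \<Longrightarrow> entry M i j = entry (type_B N) i j"
begin

abbreviation braid_cong :: "(nat list \<times> nat list) set" where
  "braid_cong \<equiv> word_cong (nodes M) (braid_relations M)"

abbreviation cox_cong :: "(nat list \<times> nat list) set" where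
  "cox_cong \<equiv> word_cong (nodes M) (coxeter_relations M)"

lemma coxeter_M: "coxeter_matrix M"
  using coxeter_matrix_type_B[of N] r_le
  by (auto simp: coxeter_matrix_def nodes_M entry_M) (auto simp: type_B_def)

lemma words_le: "u \<in> lists (nodes M) \<Longrightarrow> u \<in> lists {..N}"
  using r_le by (auto simp: nodes_M)

lemma nodes_le: "nodes M \<subseteq> {..N}"
  using r_le by (auto simp: nodes_M)

lemma nodes_range: "i \<in> nodes M \<Longrightarrow> i \<in> {1..N}"
  using r_le by (auto simp: nodes_M)

lemma lists_alternating: "i \<in> nodes M \<Longrightarrow> j \<in> nodes M \<Longrightarrow> alternating i j k \<in> lists (nodes M)"
  using set_alternating[of i j k] by (auto simp: in_lists_conv_set)

lemma braid_cox: "(u, v) \<in> braid_cong \<Longrightarrow> (u, v) \<in> cox_cong"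
proof (induction rule: word_cong.induct)
  case (rel x y u v)
  then show ?case
    using alternating_cox[OF coxeter_M]
    by (auto simp: braid_relations_def intro!: word_cong_context)
qed (auto intro: word_cong.intros)

lemma act_coxeter_relation:
  assumes "i \<in> nodes M" "j \<in> nodes M" "entry M i j = enat k"
  shows "act N (concat (replicate k [i, j])) x = x"
proof (cases "i = j")
  case True
  then have "enat k = 1" using coxeter_M assms by (auto simp: coxeter_matrix_def)
  then have "k = 1" by (simp add: one_enat_def)
  then show ?thesis using True nodes_range[OF assms(1)] by (simp add: gen_gen)
next
  case False
  have e: "entry (type_B N) i j = enat k" using assms entry_M by (simp add: nodes_M)
  have "k \<in> {2, 3, 4}"
    using type_B_entry_cases[OF nodes_range[OF assms(1)] nodes_range[OF assms(2)] False] e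
    by (metis enat.inject insertCI)
  then have "concat (replicate k [i, j]) = alternating i j k @ rev (alternating j i k)"
    by (auto simp: numeral_eq_Suc)
  then show ?thesis
    using act_alternating[OF nodes_range[OF assms(1)] nodes_range[OF assms(2)] False e]
      act_rev'[OF words_le[OF lists_alternating[OF assms(2,1)]]]
    by (simp add: act_append)
qed

lemma cox_act: "(u, v) \<in> cox_cong \<Longrightarrow> act N u = act N v"
proof (induction rule: word_cong.induct)
  case (rel x y u v)
  then obtain i j k where "x = concat (replicate k [i, j])" "y = []" "i \<in> nodes M" "j \<in> nodes M"
    "entry M i j = enat k"
    by (auto simp: coxeter_relations_def)
  then show ?case by (intro ext) (simp add: act_append act_coxeter_relation)
qed auto

lemma descent_at_last:
  assumes "ascending N f (u @ [i])"
  shows "f (act N (u @ [i]) (int i + 1)) < f (act N (u @ [i]) (int i))"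
  using assms by (simp add: ascending_append act_append)

text \<open>If the element of \<open>u\<close> has descents at \<open>i\<close> and \<open>j\<close>, both alternating words can be split off on
  the right, since the negated permutation ascends along them.\<close>

lemma dihedral_tail:
  assumes u: "u \<in> lists (nodes M)"
    and ij: "i \<in> nodes M" "j \<in> nodes M" "i \<noteq> j" "entry M i j = enat k"
    and desc: "act N u (int i + 1) < act N u (int i)" "act N u (int j + 1) < act N u (int j)"
  obtains w where "w \<in> lists (nodes M)"
    "ascending_word N (w @ rev (alternating i j k))" "act N (w @ rev (alternating i j k)) = act N u"
    "ascending_word N (w @ rev (alternating j i k))" "act N (w @ rev (alternating j i k)) = act N u"
proof -
  note r = nodes_range[OF ij(1)] nodes_range[OF ij(2)]
  have e: "entry (type_B N) i j = enat k" "entry (type_B N) j i = enat k"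
    using ij coxeter_M entry_M by (auto simp: nodes_M coxeter_matrix_def)
  have sy: "mirror_sym N (\<lambda>x. - act N u x)"
    by (intro mirror_sym_uminus mirror_sym_act_id words_le u)
  note alt = lists_alternating[OF ij(1,2), of k] lists_alternating[OF ij(2,1), of k]
  have eq: "act N (alternating i j k) x = act N (alternating j i k) x" for x
    by (rule act_alternating[OF r ij(3) e(1)])
  \<comment> \<open>\<open>w\<close> stands for the element of \<open>u\<close> times the common
    element of the two alternating words of length \<open>k\<close>, so the reverse of either word
    leads back to \<open>u\<close>.\<close>
  have "u @ alternating i j k \<in> lists (nodes M)" using u alt by simp
  then obtain w where w: "w \<in> lists (nodes M)" "ascending_word N w"
    "act N w = act N (u @ alternating i j k)"
    using ascending_word_exists[OF nodes_le] by metis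
  have a1: "ascending N (\<lambda>x. act N u (act N (alternating i j k) x)) (rev (alternating i j k))"
    using ascending_alternating[OF r ij(3) e(1) sy] desc
    by (intro ascending_rev words_le alt) simp
  have a2: "ascending N (\<lambda>x. act N u (act N (alternating j i k) x)) (rev (alternating j i k))"
    using ascending_alternating[OF r(2,1) ij(3)[symmetric] e(2) sy] desc
    by (intro ascending_rev words_le alt) simp
  show thesis
  proof (rule that[OF w(1)])
    show "ascending_word N (w @ rev (alternating i j k))"
      using w(2) a1 by (simp add: ascending_append w(3) act_append)
    show "ascending_word N (w @ rev (alternating j i k))"
      using w(2) a2 by (simp add: ascending_append w(3) act_append eq)
    show "act N (w @ rev (alternating i j k)) = act N u"
      by (intro ext) (simp add: act_append w(3) act_rev' words_le alt)
    show "act N (w @ rev (alternating j i k)) = act N u"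
      by (intro ext) (simp add: act_append w(3) eq act_rev' words_le alt)
  qed
qed

lemma act_cancel:
  assumes "i \<in> nodes M" "act N (u @ [i]) = act N (v @ [i])"
  shows "act N u = act N v"
proof
  fix x
  have "act N (u @ [i]) (gen N i x) = act N (v @ [i]) (gen N i x)" using assms(2) by simp
  then show "act N u x = act N v x"
    using nodes_range[OF assms(1)] by (simp add: act_append gen_gen)
qed

lemma alternating_relation:
  assumes "i \<in> nodes M" "j \<in> nodes M" "i \<noteq> j" "entry M i j = enat k"
  shows "(alternating i j k, alternating j i k) \<in> braid_cong"
proof -
  have "(alternating i j k, alternating j i k) \<in> braid_relations M"
    using assms by (auto simp: braid_relations_def)
  from word_cong.rel[OF this, of "nodes M" "[]" "[]"] show ?thesis
    using assms by (simp add: lists_alternating)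
qed

lemma rev_alternating:
  fixes i j :: nat
  shows "rev (alternating i j k) = (if even k then alternating j i k else alternating i j k)"
proof -
  have a: "alternating i j (Suc k) = alternating i j k @ [if even k then i else j]"
    for i j :: nat and k by (induction k arbitrary: i j) auto
  show ?thesis
  proof (induction k arbitrary: i j)
    case (Suc k)
    show ?case using Suc[of j i] Suc[of i j] a[of i j k] a[of j i k] by auto
  qed simp
qed

text \<open>If the last letters \<open>i\<close> and \<open>j\<close> differ, the common element has
  descents at both, and \<open>dihedral_tail\<close> supplies two ascending words ending in
  \<open>i\<close> and \<open>j\<close> that differ by one braid relation; the induction hypothesis
  links them to \<open>u\<close> and \<open>v\<close>. Ascent replaces minimal length because
  lengths in \<open>Cox M\<close> are not yet accessible.\<close>

theorem matsumoto:
  assumes "u \<in> lists (nodes M)" "v \<in> lists (nodes M)" "ascending_word N u" "ascending_word N v"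
    "act N u = act N v"
  shows "(u, v) \<in> braid_cong"
  using assms
proof (induction "length u" arbitrary: u v rule: less_induct)
  case less
  \<comment> \<open>A nonempty ascending word ends in a descent, while the identity has
    none.\<close>
  have nil: "w = []" if "w \<in> lists (nodes M)" "ascending_word N w" "act N w = act N []" for w
  proof (rule ccontr)
    assume "w \<noteq> []"
    then obtain w' i where w: "w = w' @ [i]" by (metis rev_exhaust)
    show False using descent_at_last[of "\<lambda>x. x" w' i] that(2,3) unfolding w by simp
  qed
  show ?case
  proof (cases "u = [] \<or> v = []")
    case True
    then have "u = []" "v = []"
      using nil[OF less.prems(1,3)] nil[OF less.prems(2,4)] less.prems(5) by auto
    then show ?thesis by (auto intro: word_cong.refl)
  next
    case False
    then obtain u' i v' j where uv: "u = u' @ [i]" "v = v' @ [j]" by (metis rev_exhaust)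
    have l: "u' \<in> lists (nodes M)" "v' \<in> lists (nodes M)" "i \<in> nodes M" "j \<in> nodes M"
      using less.prems(1,2) unfolding uv by auto
    have a: "ascending_word N u'" "ascending_word N v'"
      using less.prems(3,4) unfolding uv by (simp_all add: ascending_append)
    have snoc: "(x @ [i], y @ [i]) \<in> braid_cong" if "(x, y) \<in> braid_cong" "i \<in> nodes M" for x y i
      using that by (intro word_cong_append word_cong.refl) auto
    show ?thesis
    proof (cases "i = j")
      case True
      have "act N u' = act N v'"
        using act_cancel[OF l(4)] less.prems(5) unfolding uv True by blast
      then have "(u', v') \<in> braid_cong"
        using less.hyps[OF _ l(1,2) a] by (simp add: uv(1))
      from snoc[OF this l(4)] show ?thesis unfolding uv True .
    next
      case False
      obtain k where k: "entry M i j = enat k"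
        using type_B_entry_cases[OF nodes_range[OF l(3)] nodes_range[OF l(4)] False]
          entry_M[of i j] l(3,4) by (metis nodes_M)
      have "2 \<le> entry M i j" using coxeter_M l False by (auto simp: coxeter_matrix_def)
      then have "k > 0" using k by (cases k) (auto simp: numeral_eq_enat)
      then obtain k1 where k1: "k = Suc k1" using gr0_conv_Suc by auto
      have "act N u (int i + 1) < act N u (int i)" "act N u (int j + 1) < act N u (int j)"
        using descent_at_last[OF less.prems(3)[unfolded uv]]
          descent_at_last[OF less.prems(4)[unfolded uv]] less.prems(5) uv by simp_all
      from dihedral_tail[OF less.prems(1) l(3,4) False k this] obtain w where
        w: "w \<in> lists (nodes M)"
        and wi: "ascending_word N (w @ rev (alternating i j k))"
          "act N (w @ rev (alternating i j k)) = act N u"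
        and wj: "ascending_word N (w @ rev (alternating j i k))"
          "act N (w @ rev (alternating j i k)) = act N u" by blast
      define x y where "x = w @ rev (alternating j i k1)" and "y = w @ rev (alternating i j k1)"
      have xy: "w @ rev (alternating i j k) = x @ [i]" "w @ rev (alternating j i k) = y @ [j]"
        unfolding x_def y_def k1 by simp_all
      have lx: "x \<in> lists (nodes M)" "y \<in> lists (nodes M)"
        using w lists_alternating[OF l(3,4), of k1] lists_alternating[OF l(4,3), of k1]
        unfolding x_def y_def by (simp_all add: in_lists_conv_set ball_Un)
      have ax: "ascending_word N x" "ascending_word N y"
        using wi(1) wj(1) unfolding xy by (simp_all add: ascending_append)
      have "act N u' = act N x"
        using act_cancel[OF l(3)] wi(2) unfolding uv(1) xy by metis
      then have "(u', x) \<in> braid_cong"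
        using less.hyps[OF _ l(1) lx(1) a(1) ax(1)] by (simp add: uv(1))
      \<comment> \<open>The length of \<open>v\<close> is not known at this point. The congruence of
        \<open>u'\<close> and \<open>x\<close> determines the length of \<open>x\<close>, hence that
        of \<open>y\<close>, and so brings \<open>y\<close> within reach of the induction
        hypothesis.\<close>
      moreover have "length y = length x" unfolding x_def y_def by simp
      ultimately have len: "length y < length u"
        using braid_length[of u' x] by (simp add: uv(1))
      have "act N (y @ [j]) = act N (v' @ [j])"
        using wj(2) less.prems(5) unfolding uv(2) xy by (rule HOL.trans)
      then have "(y, v') \<in> braid_cong"
        using less.hyps[OF len lx(2) l(2) ax(2) a(2)] act_cancel[OF l(4)] by blast
      then have "(y @ [j], v) \<in> braid_cong" unfolding uv by (rule snoc[OF _ l(4)])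
      moreover have "(u, x @ [i]) \<in> braid_cong"
        unfolding uv by (rule snoc[OF \<open>(u', x) \<in> braid_cong\<close> l(3)])
      \<comment> \<open>Reversal exchanges the two alternating words when \<open>k\<close> is even,
        so the relation is needed in both directions.\<close>
      moreover have "(w @ rev (alternating i j k), w @ rev (alternating j i k)) \<in> braid_cong"
        using alternating_relation[OF l(3,4) False k]
          word_cong.sym[OF alternating_relation[OF l(3,4) False k]] w
        by (intro word_cong_append word_cong.refl) (auto simp: rev_alternating)
      ultimately show ?thesis unfolding xy by (blast intro: word_cong.trans)
    qed
  qed
qed

text \<open>At a descent \<open>i\<close>, the element of \<open>w @ [i]\<close> has an ascending
  word \<open>v\<close>, and \<open>v @ [i]\<close> is an ascending word for the element of
  \<open>w\<close>. Matsumoto's theorem turns \<open>w\<close> into \<open>v @ [i]\<close>, and the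
  doubled letter in \<open>v @ [i, i]\<close> cancels by the quadratic relation.\<close>

lemma ascending_append_gen:
  assumes "i \<in> nodes M" "w \<in> lists (nodes M)" "ascending_word N w"
  obtains v where "v \<in> lists (nodes M)" "ascending_word N v" "(w @ [i], v) \<in> cox_cong"
proof (cases "act N w (int i) < act N w (int i + 1)")
  case True
  show thesis
  proof (rule that)
    show "w @ [i] \<in> lists (nodes M)" using assms by simp
    show "ascending_word N (w @ [i])" using True assms(3) by (simp add: ascending_append)
    show "(w @ [i], w @ [i]) \<in> cox_cong" using assms by (intro word_cong.refl) simp
  qed
next
  case False
  have iN: "i \<le> N" using nodes_range[OF assms(1)] by simp
  have lt: "act N w (int i + 1) < act N w (int i)"
    using False mirror_sym_neq[OF mirror_sym_act_id[OF words_le[OF assms(2)]],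
      of "int i" "int i + 1"] by simp
  have wi: "w @ [i] \<in> lists (nodes M)" using assms by simp
  obtain v where v: "v \<in> lists (nodes M)" "ascending_word N v" "act N v = act N (w @ [i])"
    using ascending_word_exists[OF nodes_le wi] by metis
  have "ascending_word N (v @ [i])"
    using v(2) lt by (simp add: ascending_append v(3) act_append)
  moreover have "act N w = act N (v @ [i])"
    by (intro ext) (simp add: act_append v(3) gen_gen[OF iN])
  ultimately have "(w, v @ [i]) \<in> braid_cong"
    using v(1) assms by (intro matsumoto) auto
  then have "(w @ [i], (v @ [i]) @ [i]) \<in> cox_cong"
    using assms(1) braid_cox by (intro word_cong_append word_cong.refl) auto
  moreover have "(v @ rev [i] @ [i], v @ []) \<in> cox_cong"
    using word_cong_cox_rev[OF coxeter_M, of "[i]"] assms(1) v(1)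
    by (intro word_cong_append word_cong.refl) auto
  ultimately have "(w @ [i], v) \<in> cox_cong" by (auto intro: word_cong.trans)
  then show thesis using that v by blast
qed

lemma cox_ascending:
  assumes "u \<in> lists (nodes M)"
  shows "\<exists>v\<in>lists (nodes M). ascending_word N v \<and> (u, v) \<in> cox_cong"
  using assms
proof (induction u rule: rev_induct)
  case Nil
  then show ?case by (intro bexI[of _ "[]"]) (auto intro: word_cong.refl)
next
  case (snoc i u)
  then obtain w where w: "w \<in> lists (nodes M)" "ascending_word N w" "(u, w) \<in> cox_cong" by auto
  have i: "i \<in> nodes M" using snoc by simp
  obtain v where v: "v \<in> lists (nodes M)" "ascending_word N v" "(w @ [i], v) \<in> cox_cong"
    using ascending_append_gen[OF i w(1,2)] by metis
  have "(u @ [i], w @ [i]) \<in> cox_cong"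
    using w i by (intro word_cong_append word_cong.refl) auto
  then show ?case using v by (blast intro: word_cong.trans)
qed

text \<open>Faithfulness of the signed permutations: Coxeter relations bring both words to ascending
  form, and ascending words with the same action are already braid equivalent.\<close>

lemma cox_cong_iff:
  assumes "u \<in> lists (nodes M)" "v \<in> lists (nodes M)"
  shows "(u, v) \<in> cox_cong \<longleftrightarrow> act N u = act N v"
proof
  assume "act N u = act N v"
  obtain u' where u': "u' \<in> lists (nodes M)" "ascending_word N u'" "(u, u') \<in> cox_cong"
    using cox_ascending[OF assms(1)] by blast
  obtain v' where v': "v' \<in> lists (nodes M)" "ascending_word N v'" "(v, v') \<in> cox_cong"
    using cox_ascending[OF assms(2)] by blast
  have "act N u' = act N v'" using cox_act[OF u'(3)] cox_act[OF v'(3)] \<open>act N u = _\<close> by simp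
  then have "(u', v') \<in> cox_cong" using u' v' by (intro braid_cox matsumoto)
  then show "(u, v) \<in> cox_cong" using u' v' by (blast intro: word_cong.intros)
qed (rule cox_act)

section \<open>Length, reduced expressions and the lift to the Artin monoid\<close>

lemma cox_class_eq_iff:
  assumes "u \<in> lists (nodes M)" "v \<in> lists (nodes M)"
  shows "cox_class M u = cox_class M v \<longleftrightarrow> act N u = act N v"
  by (simp only: cox_class_def eq_equiv_class_iff[OF equiv_word_cong assms] cox_cong_iff[OF assms])

lemma artin_class_eq_iff:
  assumes "u \<in> lists (nodes M)" "v \<in> lists (nodes M)"
  shows "artin_class M u = artin_class M v \<longleftrightarrow> (u, v) \<in> braid_cong"
  by (simp only: artin_class_def eq_equiv_class_iff[OF equiv_word_cong assms])

lemma ascending_length_le: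
  assumes "u \<in> lists (nodes M)" "v \<in> lists (nodes M)" "ascending_word N v" "act N v = act N u"
  shows "length v \<le> length u"
proof -
  obtain w where w: "w \<in> lists (nodes M)" "ascending_word N w" "act N w = act N u"
    "length w \<le> length u"
    using ascending_word_exists[OF nodes_le assms(1)] by metis
  then have "(v, w) \<in> braid_cong" using assms by (intro matsumoto) auto
  then show ?thesis using braid_length w(4) by force
qed

lemma cox_length_eq:
  assumes "u \<in> lists (nodes M)" "v \<in> lists (nodes M)" "ascending_word N v" "act N v = act N u"
  shows "cox_length M (cox_class M u) = length v"
  unfolding cox_length_def
proof (rule Least_equality)
  show "\<exists>w\<in>lists (nodes M). cox_class M w = cox_class M u \<and> length w = length v"
    using assms(2,4) cox_class_eq_iff[OF assms(2,1)] by blast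
next
  fix k
  assume "\<exists>w\<in>lists (nodes M). cox_class M w = cox_class M u \<and> length w = k"
  then obtain w where "w \<in> lists (nodes M)" "act N w = act N u" "length w = k"
    using cox_class_eq_iff[OF _ assms(1)] by blast
  then show "length v \<le> k" using ascending_length_le[of w v] assms by simp
qed

text \<open>A word that is not ascending could be shortened by \<open>ascending_or_shorter\<close>,
  against the minimality of its length.\<close>

lemma ascending_if_reduced:
  assumes "u \<in> lists (nodes M)" "reduced_expression M (cox_class M u) v"
  shows "v \<in> lists (nodes M)" "ascending_word N v" "act N v = act N u"
proof -
  have v: "v \<in> lists (nodes M)" "cox_class M v = cox_class M u"
    "length v = cox_length M (cox_class M u)"
    using assms by (auto simp: reduced_expression_def)
  show "v \<in> lists (nodes M)" by fact
  show av: "act N v = act N u" using v(2) cox_class_eq_iff[OF v(1) assms(1)] by simp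
  obtain w where w: "w \<in> lists (nodes M)" "ascending_word N w" "act N w = act N u"
    using ascending_word_exists[OF nodes_le assms(1)] by metis
  have "length v = length w" using v(3) cox_length_eq[OF assms(1) w] by simp
  moreover have "length w \<le> length v'" if "v' \<in> lists (nodes M)" "act N v' = act N v" for v'
    using ascending_length_le[OF that(1) w(1,2)] that(2) av w(3) by simp
  ultimately show "ascending_word N v"
    using ascending_or_shorter[OF nodes_le v(1)] by force
qed

lemma reduced_if_ascending:
  assumes "u \<in> lists (nodes M)" "v \<in> lists (nodes M)" "ascending_word N v" "act N v = act N u"
  shows "reduced_expression M (cox_class M u) v"
  using cox_length_eq[OF assms] assms cox_class_eq_iff[OF assms(2,1)]
  by (simp add: reduced_expression_def)

text \<open>Whatever reduced word the choice in \<open>artin_lift\<close> returns, it is ascending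
  and acts like \<open>v\<close>, so Matsumoto's theorem removes the choice.\<close>

lemma artin_lift_eq:
  assumes "u \<in> lists (nodes M)" "v \<in> lists (nodes M)" "ascending_word N v" "act N v = act N u"
  shows "artin_lift M (cox_class M u) = artin_class M v"
proof -
  let ?w = "SOME w. reduced_expression M (cox_class M u) w"
  have "reduced_expression M (cox_class M u) ?w"
    using reduced_if_ascending[OF assms] by (rule someI)
  note w = ascending_if_reduced[OF assms(1) this]
  then have "(?w, v) \<in> braid_cong" using assms by (intro matsumoto) auto
  then show ?thesis unfolding artin_lift_def using artin_class_eq_iff[OF w(1) assms(2)] by blast
qed

text \<open>Ascent reads a word from the left and is not visibly symmetric. The argument goes
  through length: a shorter word for the inverse, reversed, would be a shorter word for
  \<open>u\<close>.\<close>

lemma ascending_word_rev: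
  assumes "u \<in> lists (nodes M)" "ascending_word N u"
  shows "ascending_word N (rev u)"
proof -
  have rv: "rev u \<in> lists (nodes M)" using assms by (simp add: in_lists_conv_set)
  have inv: "act N (rev v) = act N u" if "v \<in> lists (nodes M)" "act N v = act N (rev u)" for v
  proof
    fix x
    have "act N v (act N u x) = x" by (simp add: that act_rev[OF words_le[OF assms(1)]])
    then show "act N (rev v) x = act N u x" using act_rev[OF words_le[OF that(1)]] by metis
  qed
  have "\<not> length v < length (rev u)" if "v \<in> lists (nodes M)" "act N v = act N (rev u)" for v
    using ascending_length_le[of "rev v" u] inv[OF that] assms that(1)
    by (simp add: in_lists_conv_set)
  then show ?thesis using ascending_or_shorter[OF nodes_le rv] by blast
qed

end

section \<open>Longest elements\<close>

text \<open>An integer \<open>k\<close> stands here for the gap between the positions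
  \<open>k\<close> and \<open>k + 1\<close>; generator \<open>j\<close> acts across the gaps
  \<open>j\<close> and \<open>2 * N - j\<close>.\<close>

definition mirror_nodes :: "nat \<Rightarrow> nat set \<Rightarrow> int set" where
  "mirror_nodes N J = {k. \<exists>j\<in>J. k = int j \<or> k = 2 * int N - int j}"

text \<open>The half-open interval consists of the gaps between \<open>a\<close> and
  \<open>b\<close>, so linked positions lie in a common run of positions that \<open>J\<close> and
  its mirror can permute.\<close>

definition linked :: "nat \<Rightarrow> nat set \<Rightarrow> int \<Rightarrow> int \<Rightarrow> bool" where
  "linked N J a b \<longleftrightarrow> {min a b..<max a b} \<subseteq> mirror_nodes N J"

lemma linked_refl [simp]: "linked N J a a"
  by (simp add: linked_def)

lemma linked_sym: "linked N J a b \<Longrightarrow> linked N J b a"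
  by (simp add: linked_def min.commute max.commute)

lemma linked_trans: "linked N J a b \<Longrightarrow> linked N J b c \<Longrightarrow> linked N J a c"
proof -
  have "{min a c..<max a c} \<subseteq> {min a b..<max a b} \<union> {min b c..<max b c}" by auto
  then show "linked N J a b \<Longrightarrow> linked N J b c \<Longrightarrow> linked N J a c"
    unfolding linked_def by blast
qed

lemma linked_Suc: "j \<in> J \<Longrightarrow> linked N J (int j) (int j + 1)"
  unfolding linked_def mirror_nodes_def by (intro subsetI CollectI bexI[of _ j]) auto

lemma linked_mirror: "j \<in> J \<Longrightarrow> linked N J (2 * int N - int j) (2 * int N + 1 - int j)"
  unfolding linked_def mirror_nodes_def by (intro subsetI CollectI bexI[of _ j]) auto

lemma linked_gen: "j \<in> J \<Longrightarrow> j \<le> N \<Longrightarrow> linked N J (gen N j x) x"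
  by (erule gen_cases[of j N x]) (simp_all add: linked_Suc linked_mirror linked_sym)

lemma linked_act: "u \<in> lists J \<Longrightarrow> J \<subseteq> {..N} \<Longrightarrow> linked N J (act N u x) x"
proof (induction u rule: list.induct)
  case (Cons j u)
  then have "linked N J (gen N j (act N u x)) (act N u x)" "linked N J (act N u x) x"
    by (auto intro!: linked_gen)
  then show ?case by (simp add: linked_trans)
qed simp

text \<open>Mirror symmetry carries the ascents at \<open>J\<close> to the mirrored gaps, so
  \<open>f\<close> increases across every gap between \<open>a\<close> and \<open>b\<close>.\<close>

lemma linked_act_mono:
  assumes "mirror_sym N f" "\<And>j. j \<in> J \<Longrightarrow> f (int j) < f (int j + 1)"
    and "linked N J a b" "a < b"
  shows "f a < f b"
proof -
  have step: "f k < f (k + 1)" if "k \<in> {a..<b}" for k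
  proof -
    have "\<exists>j\<in>J. k = int j \<or> k = 2 * int N - int j"
      using assms(3,4) that by (auto simp: linked_def mirror_nodes_def)
    then obtain j where j: "j \<in> J" "k = int j \<or> k = 2 * int N - int j" by blast
    have "f (2 * int N + 1 - int j) - f (2 * int N + 1 - (int j + 1)) = f (int j + 1) - f (int j)"
      by (rule mirror_sym_step[OF assms(1)])
    then have "f (2 * int N - int j) < f (2 * int N + 1 - int j)"
      using assms(2)[OF j(1)] by simp
    moreover have "2 * int N + 1 - int j = 2 * int N - int j + 1" by simp
    ultimately have "f (2 * int N - int j) < f (2 * int N - int j + 1)" by (simp only:)
    then show ?thesis using assms(2)[OF j(1)] j(2) by (elim disjE) (simp_all only:)
  qed
  have "c \<le> b \<longrightarrow> f a < f c" if "a + 1 \<le> c" for c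
    using that
  proof (induction c rule: int_ge_induct)
    case base
    then show ?case using step[of a] by simp
  next
    case (step c)
    then show ?case using \<open>c \<in> {a..<b} \<Longrightarrow> f c < f (c + 1)\<close> by auto
  qed
  then show ?thesis using assms(4) by simp
qed

lemma linked_mono_iff:
  assumes "mirror_sym N f" "\<And>j. j \<in> J \<Longrightarrow> f (int j) < f (int j + 1)" "linked N J a b"
  shows "f a < f b \<longleftrightarrow> a < b"
  using linked_act_mono[OF assms(1,2,3)] linked_act_mono[OF assms(1,2) linked_sym[OF assms(3)]]
  by (metis not_less_iff_gr_or_eq)

text \<open>A minimal coset representative followed by a reduced word of the parabolic subgroup is reduced.\<close>

lemma ascending_parabolic:
  assumes "mirror_sym N f" "\<And>j. j \<in> J \<Longrightarrow> f (int j) < f (int j + 1)" "J \<subseteq> {..N}"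
    and "v \<in> lists J" "u \<in> lists J"
  shows "ascending N (\<lambda>x. f (act N u x)) v \<longleftrightarrow> ascending N (act N u) v"
  using assms(4,5)
proof (induction v arbitrary: u rule: list.induct)
  case (Cons i v)
  have "ascending N (\<lambda>x. f (act N (u @ [i]) x)) v \<longleftrightarrow> ascending N (act N (u @ [i])) v"
    using Cons by simp
  moreover have "linked N J (act N u (int i)) (act N u (int i + 1))"
    using Cons.prems linked_act[OF Cons.prems(2) assms(3)]
    by (meson Cons_in_lists_iff linked_Suc linked_sym linked_trans)
  from linked_mono_iff[OF assms(1,2) this]
  have "f (act N u (int i)) < f (act N u (int i + 1)) \<longleftrightarrow> act N u (int i) < act N u (int i + 1)"
    by simp
  moreover have "act N (u @ [i]) = (\<lambda>x. act N u (gen N i x))"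
    by (intro ext) (simp add: act_append)
  ultimately show ?case by simp
qed simp

lemma ascending_parabolic_id:
  assumes "mirror_sym N f" "\<And>j. j \<in> J \<Longrightarrow> f (int j) < f (int j + 1)" "J \<subseteq> {..N}" "v \<in> lists J"
  shows "ascending N f v \<longleftrightarrow> ascending_word N v"
proof -
  have "act N [] = (\<lambda>x. x)" by auto
  then show ?thesis using ascending_parabolic[OF assms, of "[]"] by simp
qed

text \<open>Longest elements are described by descents at all of \<open>J\<close> instead of by
  maximal length, because descents can be read off from the permutation and determine its
  values.\<close>

definition longest_word :: "nat \<Rightarrow> nat set \<Rightarrow> nat list \<Rightarrow> bool" where
  "longest_word N J w \<longleftrightarrow>
     w \<in> lists J \<and> ascending_word N w \<and> (\<forall>j\<in>J. act N w (int j + 1) < act N w (int j))"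

section \<open>Existence and uniqueness of longest words\<close>

lemma gen_permutes:
  assumes "i \<in> {1..N}"
  shows "gen N i permutes {1..2 * int N}"
proof (rule bij_imp_permutes)
  show "bij_betw (gen N i) {1..2 * int N} {1..2 * int N}"
  proof (rule bij_betw_byWitness[where f' = "gen N i"])
    have i: "i \<le> N" "1 \<le> i" using assms by auto
    have "gen N i x \<in> {1..2 * int N}" if "x \<in> {1..2 * int N}" for x
      using that i by (cases rule: gen_cases[OF i(1), of x]) auto
    then show "gen N i ` {1..2 * int N} \<subseteq> {1..2 * int N}" by blast
    then show "gen N i ` {1..2 * int N} \<subseteq> {1..2 * int N}" .
  qed (use assms in \<open>auto simp: gen_gen\<close>)
  show "gen N i x = x" if "x \<notin> {1..2 * int N}" for x
    using that assms by (intro gen_fixed) auto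
qed

lemma act_permutes: "u \<in> lists {1..N} \<Longrightarrow> act N u permutes {1..2 * int N}"
proof (induction u rule: list.induct)
  case Nil
  have "act N [] = id" by auto
  then show ?case by (simp only: permutes_id)
next
  case (Cons i u)
  have "act N (i # u) = gen N i \<circ> act N u" by auto
  moreover have "act N u permutes {1..2 * int N}" "gen N i permutes {1..2 * int N}"
    using Cons by (simp_all add: gen_permutes)
  ultimately show ?case using permutes_compose by metis
qed

lemma finite_act_image: "J \<subseteq> {1..N} \<Longrightarrow> finite (act N ` lists J)"
proof (rule finite_subset)
  assume "J \<subseteq> {1..N}"
  then have "lists J \<subseteq> lists {1..N}" by (rule lists_mono)
  then show "act N ` lists J \<subseteq> {p. p permutes {1..2 * int N}}" using act_permutes by blast
qed (simp add: finite_permutations)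

context sub_type_B
begin

lemma ascending_length_unique:
  assumes "u \<in> lists (nodes M)" "v \<in> lists (nodes M)" "ascending_word N u" "ascending_word N v"
    "act N u = act N v"
  shows "length u = length v"
  using braid_length[OF matsumoto[OF assms]] .

text \<open>An ascending word of maximal length over \<open>J\<close> has no ascent in
  \<open>J\<close>, since it could be extended there. A maximum exists because the length of an
  ascending word depends only on its permutation, and there are finitely many of these.\<close>

lemma longest_word_exists:
  assumes "J \<subseteq> nodes M"
  obtains w where "longest_word N J w"
proof -
  let ?A = "{w \<in> lists J. ascending_word N w}"
  have J: "lists J \<subseteq> lists (nodes M)" using assms by (rule lists_mono)
  have "finite (act N ` ?A)"
    using finite_act_image[of J N] assms nodes_range
    by (intro finite_subset[OF _ finite_act_image[of J N]]) auto
  moreover have "length ` ?A \<subseteq> (\<lambda>p. length (SOME w. w \<in> ?A \<and> act N w = p)) ` (act N ` ?A)"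
  proof
    fix l
    assume "l \<in> length ` ?A"
    then obtain w where w: "w \<in> ?A" "l = length w" by blast
    let ?v = "SOME v. v \<in> ?A \<and> act N v = act N w"
    from w(1) have "w \<in> ?A \<and> act N w = act N w" by blast
    then have v: "?v \<in> ?A \<and> act N ?v = act N w"
      by (rule someI[of "\<lambda>v. v \<in> ?A \<and> act N v = act N w"])
    have "?v \<in> lists (nodes M)" "w \<in> lists (nodes M)" "ascending_word N ?v" "ascending_word N w"
      using v w(1) J by blast+
    from ascending_length_unique[OF this] v have "l = length ?v" by (simp only: w(2))
    with imageI[OF w(1), of "act N"]
    show "l \<in> (\<lambda>p. length (SOME w. w \<in> ?A \<and> act N w = p)) ` (act N ` ?A)"
      by (intro image_eqI[of l _ "act N w"]) (simp_all only:)
  qed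
  ultimately have fin: "finite (length ` ?A)" by (meson finite_imageI finite_subset)
  have ne: "length ` ?A \<noteq> {}" by (auto intro: exI[of _ "[]"])
  obtain w where max: "Max (length ` ?A) = length w" and w: "w \<in> ?A"
    by (rule imageE[OF Max_in[OF fin ne]])
  have "act N w (int j + 1) < act N w (int j)" if j: "j \<in> J" for j
  proof (rule ccontr)
    assume "\<not> ?thesis"
    moreover have "act N w (int j) \<noteq> act N w (int j + 1)"
      using w J by (intro mirror_sym_neq[OF mirror_sym_act_id[OF words_le]]) auto
    ultimately have "w @ [j] \<in> ?A" using w j by (simp add: ascending_append)
    then have "length (w @ [j]) \<le> length w" unfolding max[symmetric] by (intro Max_ge fin imageI)
    then show False by simp
  qed
  then show thesis using w that by (auto simp: longest_word_def)
qed

text \<open>All of \<open>J\<close> are descents of \<open>w\<close>, so the negated permutation of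
  \<open>w\<close> ascends along every ascending word \<open>v\<close> over \<open>J\<close>. Read
  backwards, \<open>rev v\<close> is the end of an ascending word for \<open>w\<close>, and
  \<open>x\<close> is a word for the element of \<open>w @ v\<close>.\<close>

lemma longest_word_complement:
  assumes "J \<subseteq> nodes M" "longest_word N J w" "v \<in> lists J" "ascending_word N v"
  obtains x where "x \<in> lists J" "ascending_word N (x @ rev v)" "act N (x @ rev v) = act N w"
    "length x + length v = length w"
proof -
  have J: "J \<subseteq> {..N}" using assms(1) nodes_le by blast
  have lJ: "u \<in> lists (nodes M)" if "u \<in> lists J" for u using that assms(1) lists_mono by blast
  have w: "w \<in> lists J" "ascending_word N w" "\<And>j. j \<in> J \<Longrightarrow> act N w (int j + 1) < act N w (int j)"
    using assms(2) by (auto simp: longest_word_def)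
  have "ascending N (\<lambda>x. - act N w x) v"
    using ascending_parabolic_id[of N "\<lambda>x. - act N w x" J v] w(1,3) J assms(3,4) lJ
    by (simp add: mirror_sym_uminus mirror_sym_act_id words_le)
  then have asc: "ascending N (\<lambda>x. act N w (act N v x)) (rev v)"
    using ascending_rev[OF words_le[OF lJ[OF assms(3)]]] by blast
  have "w @ v \<in> lists J" using w(1) assms(3) by simp
  then obtain x where x: "x \<in> lists J" "ascending_word N x" "act N x = act N (w @ v)"
    using ascending_word_exists[OF J] by metis
  have 1: "ascending_word N (x @ rev v)"
    using asc x by (simp add: ascending_append act_append)
  have 2: "act N (x @ rev v) = act N w"
    by (intro ext) (simp add: act_append x(3) act_rev'[OF words_le[OF lJ[OF assms(3)]]])
  have "x @ rev v \<in> lists (nodes M)" using x(1) assms(3) lJ by (simp add: in_lists_conv_set ball_Un)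
  from ascending_length_unique[OF this lJ[OF w(1)] 1 w(2) 2] have "length x + length v = length w"
    by simp
  then show thesis using that x(1) 1 2 by blast
qed

text \<open>For a word at least as long as \<open>w\<close> the complement \<open>x\<close> is
  empty, so \<open>w\<close> acts as the inverse of \<open>v\<close>. Applied to \<open>w\<close>
  itself this makes \<open>w\<close> an involution, and the two facts together identify
  \<open>v\<close> with \<open>w\<close>.\<close>

lemma longest_word_act_unique:
  assumes "J \<subseteq> nodes M" "longest_word N J w" "v \<in> lists J" "ascending_word N v"
    "length w \<le> length v"
  shows "act N v = act N w"
proof -
  have lJ: "u \<in> lists (nodes M)" if "u \<in> lists J" for u using that assms(1) lists_mono by blast
  have inv: "act N (rev v) = act N w" if "v \<in> lists J" "ascending_word N v" "length w \<le> length v"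
    for v
  proof -
    note v = that
    obtain x where x: "act N (x @ rev v) = act N w" "length x + length v = length w"
      using longest_word_complement[OF assms(1,2) v(1,2)] by metis
    then have "length x = 0" using v(3) by linarith
    then have "x = []" by simp
    with x(1) show ?thesis by simp
  qed
  have w: "w \<in> lists J" "ascending_word N w" using assms(2) by (auto simp: longest_word_def)
  have "act N w (act N v y) = y" for y
    using inv[OF assms(3-5)] act_rev[OF words_le[OF lJ[OF assms(3)]], of y] by simp
  moreover have "act N w (act N w y) = y" for y
    using inv[OF w order.refl] act_rev[OF words_le[OF lJ[OF w(1)]], of y] by simp
  ultimately show ?thesis by (metis ext)
qed

text \<open>The generators are their own inverses, so products of generators exhaust the
  subgroup.\<close>

lemma parabolic_eq_image:
  assumes "J \<subseteq> nodes M"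
  shows "parabolic M J = cox_class M ` lists J"
proof -
  interpret group "Cox M" by (rule group_Cox[OF coxeter_M])
  have lJ: "u \<in> lists (nodes M)" if "u \<in> lists J" for u using that assms lists_mono by blast
  have mult: "cox_class M u \<otimes>\<^bsub>Cox M\<^esub> cox_class M v = cox_class M (u @ v)"
    if "u \<in> lists J" "v \<in> lists J" for u v
    using mult_presented_monoid[OF lJ[OF that(1)] lJ[OF that(2)]]
    by (simp add: Cox_def cox_class_def)
  have one: "\<one>\<^bsub>Cox M\<^esub> = cox_class M []"
    by (simp add: Cox_def cox_class_def one_presented_monoid)
  have car: "cox_class M u \<in> carrier (Cox M)" if "u \<in> lists J" for u
    using lJ[OF that] by (auto simp: Cox_def cox_class_def carrier_presented_monoid)
  have inv: "inv\<^bsub>Cox M\<^esub> (cox_gen M j) = cox_gen M j" if "j \<in> J" for j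
  proof (rule inv_equality)
    have "(rev [j] @ [j], []) \<in> cox_cong"
      using that assms by (intro word_cong_cox_rev coxeter_M) auto
    then have "cox_class M ([j] @ [j]) = cox_class M []"
      using equiv_class_eq[OF equiv_word_cong] by (simp add: cox_class_def)
    then show "cox_gen M j \<otimes>\<^bsub>Cox M\<^esub> cox_gen M j = \<one>\<^bsub>Cox M\<^esub>"
      using mult[of "[j]" "[j]"] that by (simp add: one cox_gen_def)
  qed (use car[of "[j]"] that in \<open>simp_all add: cox_gen_def\<close>)
  show ?thesis
  proof
    show "parabolic M J \<subseteq> cox_class M ` lists J"
    proof
      fix x
      assume "x \<in> parabolic M J"
      then have "x \<in> generate (Cox M) (cox_gen M ` J)" by (simp add: parabolic_def)
      then show "x \<in> cox_class M ` lists J"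
      proof (induction rule: generate.induct)
        case one
        show ?case unfolding \<open>\<one>\<^bsub>Cox M\<^esub> = cox_class M []\<close> by simp
      next
        case (incl h)
        then show ?case by (auto simp: cox_gen_def)
      next
        case (inv h)
        then obtain j where "j \<in> J" "h = cox_gen M j" by blast
        then show ?case
          using \<open>\<And>j. j \<in> J \<Longrightarrow> inv\<^bsub>Cox M\<^esub> (cox_gen M j) = cox_gen M j\<close>
          by (auto simp: cox_gen_def)
      next
        case (eng h1 h2)
        then obtain u v where "u \<in> lists J" "v \<in> lists J" "h1 = cox_class M u" "h2 = cox_class M v"
          by blast
        then show ?case using mult[of u v] by (metis append_in_lists_conv imageI)
      qed
    qed
    show "cox_class M ` lists J \<subseteq> parabolic M J"
    proof
      fix x
      assume "x \<in> cox_class M ` lists J"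
      then obtain u where u: "u \<in> lists J" "x = cox_class M u" by blast
      have "cox_class M u \<in> generate (Cox M) (cox_gen M ` J)"
        using u(1)
      proof (induction u rule: list.induct)
        case Nil
        show ?case using generate.one[of "Cox M"] by (simp add: one)
      next
        case (Cons j u)
        then have "cox_class M [j] \<otimes>\<^bsub>Cox M\<^esub> cox_class M u \<in> generate (Cox M) (cox_gen M ` J)"
          by (intro generate.eng[OF generate.incl]) (auto simp: cox_gen_def)
        then show ?case using mult[of "[j]" u] Cons.prems by simp
      qed
      then show "x \<in> parabolic M J" by (simp add: u parabolic_def)
    qed
  qed
qed

lemma parabolic_ascending:
  assumes "J \<subseteq> nodes M" "x \<in> parabolic M J"
  obtains v where "v \<in> lists J" "ascending_word N v" "x = cox_class M v"
    "cox_length M x = length v"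
proof -
  have lJ: "u \<in> lists (nodes M)" if "u \<in> lists J" for u using that assms(1) lists_mono by blast
  have J: "J \<subseteq> {..N}" using assms(1) nodes_le by blast
  obtain u where u: "u \<in> lists J" "x = cox_class M u"
    using assms parabolic_eq_image by blast
  then obtain v where v: "v \<in> lists J" "ascending_word N v" "act N v = act N u"
    using ascending_word_exists[OF J] by metis
  have "x = cox_class M v" using cox_class_eq_iff[OF lJ[OF u(1)] lJ[OF v(1)]] v(3) u(2) by simp
  then show thesis
    using that v cox_length_eq[OF lJ[OF v(1)] lJ[OF v(1)] v(2)] by simp
qed

text \<open>\<open>longest\<close> is a choice among elements of maximal length. The length bound
  from \<open>longest_word_complement\<close> shows that \<open>w\<close> attains the maximum, and
  \<open>longest_word_act_unique\<close> that nothing else does.\<close>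

lemma longest_eq:
  assumes "J \<subseteq> nodes M" "longest_word N J w"
  shows "longest M J = cox_class M w"
proof -
  have lJ: "u \<in> lists (nodes M)" if "u \<in> lists J" for u using that assms(1) lists_mono by blast
  have w: "w \<in> lists J" "ascending_word N w" using assms(2) by (auto simp: longest_word_def)
  have lw: "cox_length M (cox_class M w) = length w"
    using cox_length_eq[OF lJ[OF w(1)] lJ[OF w(1)] w(2)] by simp
  have wp: "cox_class M w \<in> parabolic M J" using parabolic_eq_image[OF assms(1)] w by blast
  have le: "cox_length M x \<le> length w" if x: "x \<in> parabolic M J" for x
  proof -
    obtain v where v: "v \<in> lists J" "ascending_word N v" "cox_length M x = length v"
      using parabolic_ascending[OF assms(1) x] by metis
    obtain y :: "nat list" where "length y + length v = length w"
      using longest_word_complement[OF assms v(1,2)] by metis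
    then show ?thesis using v(3) by simp
  qed
  have "is_arg_max (cox_length M) (\<lambda>x. x \<in> parabolic M J) (cox_class M w)"
    unfolding is_arg_max_linorder using le wp lw by auto
  then have "is_arg_max (cox_length M) (\<lambda>x. x \<in> parabolic M J) (longest M J)"
    unfolding longest_def arg_max_on_def arg_max_def by (rule someI)
  then have l: "longest M J \<in> parabolic M J" "length w \<le> cox_length M (longest M J)"
    unfolding is_arg_max_linorder using wp lw by force+
  obtain v where v: "v \<in> lists J" "ascending_word N v" "longest M J = cox_class M v"
    "cox_length M (longest M J) = length v"
    using parabolic_ascending[OF assms(1) l(1)] by metis
  then have "act N v = act N w" using longest_word_act_unique[OF assms v(1,2)] l(2) by simp
  then show ?thesis using v(3) cox_class_eq_iff[OF lJ[OF v(1)] lJ[OF w(1)]] by simp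
qed

lemma finite_parabolic:
  assumes "J \<subseteq> nodes M"
  shows "finite (parabolic M J)"
proof -
  have lJ: "u \<in> lists (nodes M)" if "u \<in> lists J" for u using that assms(1) lists_mono by blast
  obtain w where w: "longest_word N J w" using longest_word_exists[OF assms] .
  have fJ: "finite J" using assms nodes_M finite_subset by fastforce
  have "parabolic M J \<subseteq> cox_class M ` {u. set u \<subseteq> J \<and> length u \<le> length w}"
  proof
    fix x
    assume "x \<in> parabolic M J"
    then obtain v where v: "v \<in> lists J" "ascending_word N v" "x = cox_class M v"
      using parabolic_ascending[OF assms] by metis
    obtain y :: "nat list" where "length y + length v = length w"
      using longest_word_complement[OF assms w v(1,2)] by metis
    then show "x \<in> cox_class M ` {u. set u \<subseteq> J \<and> length u \<le> length w}"
      using v by (intro image_eqI[of _ _ v]) auto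
  qed
  then show ?thesis
    using finite_lists_length_le[OF fJ] by (rule finite_subset[OF _ finite_imageI])
qed

end

section \<open>Cabling\<close>

text \<open>Falling by at least 1 per step from \<open>f a <= b\<close> bounds \<open>f\<close> from
  above, climbing back by at least 1 per step from \<open>f b >= a\<close> bounds it from below, and
  the two bounds agree.\<close>

lemma decreasing_reversal:
  fixes f :: "int \<Rightarrow> int"
  assumes dec: "\<And>k. a \<le> k \<Longrightarrow> k < b \<Longrightarrow> f (k + 1) < f k"
    and range: "\<And>x. a \<le> x \<Longrightarrow> x \<le> b \<Longrightarrow> a \<le> f x \<and> f x \<le> b"
    and x: "a \<le> x" "x \<le> b"
  shows "f x = a + b - x"
proof -
  have "y \<le> b \<longrightarrow> f y \<le> a + b - y" if "a \<le> y" for y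
    using that
  proof (induction y rule: int_ge_induct)
    case base
    then show ?case using range[of a] by simp
  next
    case (step y)
    then show ?case using dec[of y] by auto
  qed
  moreover have "a \<le> y \<longrightarrow> a + b - y \<le> f y" if "y \<le> b" for y
    using that
  proof (induction y rule: int_le_induct)
    case base
    then show ?case using range[of b] by simp
  next
    case (step y)
    then show ?case using dec[of "y - 1"] by auto
  qed
  ultimately show ?thesis using x by (meson order.antisym)
qed

text \<open>The positions from \<open>a\<close> to \<open>b\<close> form a maximal run: all gaps
  inside are available, the gaps \<open>a - 1\<close> and \<open>b\<close> on either side are not.
  The word cannot leave the run and has a descent at every gap inside, so it reverses the
  run.\<close>

lemma act_longest_word:
  assumes w: "longest_word N J w" and J: "J \<subseteq> {..N}"
    and sub: "{a..<b} \<subseteq> mirror_nodes N J" "a - 1 \<notin> mirror_nodes N J" "b \<notin> mirror_nodes N J"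
    and x: "a \<le> x" "x \<le> b"
  shows "act N w x = a + b - x"
proof (rule decreasing_reversal[OF _ _ x])
  have wJ: "w \<in> lists J" and d: "\<And>j. j \<in> J \<Longrightarrow> act N w (int j + 1) < act N w (int j)"
    using w by (auto simp: longest_word_def)
  have "w \<in> lists {..N}" using wJ lists_mono[OF J] by blast
  then have sy: "mirror_sym N (\<lambda>x. - act N w x)"
    by (intro mirror_sym_uminus mirror_sym_act_id)
  show "act N w (k + 1) < act N w k" if "a \<le> k" "k < b" for k
  proof -
    have "linked N J k (k + 1)"
      using that sub(1) by (auto simp: linked_def)
    from linked_act_mono[OF sy _ this] d show ?thesis by simp
  qed
  show "a \<le> act N w x \<and> act N w x \<le> b" if "a \<le> x" "x \<le> b" for x
  proof (rule ccontr)
    assume "\<not> ?thesis"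
    then have "a - 1 \<in> {min (act N w x) x..<max (act N w x) x} \<or>
      b \<in> {min (act N w x) x..<max (act N w x) x}"
      using that by auto
    then show False using linked_act[OF wJ J, of x] sub(2,3) unfolding linked_def by blast
  qed
qed

text \<open>Position \<open>m * (q - 1) + r\<close> with \<open>1 \<le> r \<le> m\<close> is the \<open>r\<close>-th strand of the \<open>q\<close>-th cable.\<close>

definition cable :: "nat \<Rightarrow> (int \<Rightarrow> int) \<Rightarrow> int \<Rightarrow> int" where
  "cable m f x = int m * (f ((x - 1) div int m + 1) - 1) + (x - 1) mod int m + 1"

section \<open>Cable coordinates and cabled permutations\<close>

lemma cable_at:
  assumes "1 \<le> r" "r \<le> int m"
  shows "cable m f (int m * (q - 1) + r) = int m * (f q - 1) + r"
proof -
  have "(int m * (q - 1) + r - 1) div int m = q - 1"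
    "(int m * (q - 1) + r - 1) mod int m = r - 1"
    using assms by (simp_all add: div_pos_pos_trivial add_diff_eq[symmetric] del: add_diff_eq)
  then show ?thesis by (simp add: cable_def)
qed

lemma strand_cases:
  assumes "0 < m"
  obtains q r where "x = int m * (q - 1) + r" "1 \<le> r" "r \<le> int m"
proof (rule that[of "(x - 1) div int m + 1" "(x - 1) mod int m + 1"])
  show "x = int m * ((x - 1) div int m + 1 - 1) + ((x - 1) mod int m + 1)"
    using mult_div_mod_eq[of "int m" "x - 1"] by simp
qed (use assms in \<open>auto simp: add1_zle_eq\<close>)

lemma less_strand_iff:
  assumes "1 \<le> r" "r \<le> int m"
  shows "int m * t < int m * (q - 1) + r \<longleftrightarrow> t < q"
proof
  assume *: "int m * t < int m * (q - 1) + r"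
  show "t < q"
  proof (rule ccontr)
    assume "\<not> t < q"
    then have "int m * q \<le> int m * t" by (intro mult_left_mono) auto
    moreover have "int m * (q - 1) + int m = int m * q" by (simp add: algebra_simps)
    ultimately show False using * assms by linarith
  qed
next
  assume "t < q"
  then have "int m * t \<le> int m * (q - 1)" by (intro mult_left_mono) auto
  then show "int m * t < int m * (q - 1) + r" using assms by linarith
qed

lemma cable_id: "0 < m \<Longrightarrow> cable m (\<lambda>x. x) x = x"
  by (rule strand_cases[of m x]) (auto simp: cable_at)

lemma cable_cable: "0 < m \<Longrightarrow> cable m f (cable m g x) = cable m (\<lambda>x. f (g x)) x"
  by (rule strand_cases[of m x]) (auto simp: cable_at)

lemma strand_mirror:
  "2 * int (n * m) + 1 - (int m * (q - 1) + r) = int m * (2 * int n + 1 - q - 1) + (int m + 1 - r)"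
  by (simp add: algebra_simps)

lemma strand_inject:
  assumes "1 \<le> r" "r \<le> int m" "1 \<le> r'" "r' \<le> int m"
    "int m * (q - 1) + r = int m * (q' - 1) + r'"
  shows "q = q' \<and> r = r'"
proof -
  have "t < q \<longleftrightarrow> t < q'" for t
    using less_strand_iff[OF assms(1,2), of t q] less_strand_iff[OF assms(3,4), of t q'] assms(5)
    by simp
  from this[of "q - 1"] this[of "q' - 1"] have "q = q'" by linarith
  then show ?thesis using assms(5) by simp
qed

lemma mirror_sym_cable:
  assumes "0 < m" "mirror_sym n f"
  shows "mirror_sym (n * m) (cable m f)"
proof -
  obtain c where c: "\<And>x. f x + f (2 * int n + 1 - x) = c" and inj: "inj f"
    using assms(2) by (auto simp: mirror_sym_def)
  \<comment> \<open>The images of a cable and of its mirror cable contribute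
    \<open>m * (c - 2)\<close>, the strand numbers \<open>r\<close> and \<open>m + 1 - r\<close>
    contribute \<open>m + 1\<close>.\<close>
  have "cable m f x + cable m f (2 * int (n * m) + 1 - x) = int m * (c - 2) + int m + 1" for x
  proof (rule strand_cases[OF assms(1), of x])
    fix q r
    assume x: "x = int m * (q - 1) + r" "1 \<le> r" "r \<le> int m"
    have b: "cable m f (2 * int (n * m) + 1 - x) =
      int m * (f (2 * int n + 1 - q) - 1) + (int m + 1 - r)"
      unfolding x(1) strand_mirror using x(2,3) by (intro cable_at) auto
    have a: "cable m f x = int m * (f q - 1) + r" unfolding x(1) by (rule cable_at[OF x(2,3)])
    have "cable m f x + cable m f (2 * int (n * m) + 1 - x) =
        int m * (f q + f (2 * int n + 1 - q) - 2) + int m + 1"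
      unfolding a b by (simp add: algebra_simps)
    then show ?thesis by (simp only: c)
  qed
  moreover have "inj (cable m f)"
  proof (rule injI)
    fix x y
    assume eq: "cable m f x = cable m f y"
    obtain q r where x: "x = int m * (q - 1) + r" "1 \<le> r" "r \<le> int m"
      by (rule strand_cases[OF assms(1)])
    obtain q' r' where y: "y = int m * (q' - 1) + r'" "1 \<le> r'" "r' \<le> int m"
      by (rule strand_cases[OF assms(1)])
    have "f q = f q' \<and> r = r'"
      using eq x y by (intro strand_inject) (simp_all add: cable_at)
    then show "x = y" using inj x y by (auto simp: inj_def)
  qed
  ultimately show ?thesis unfolding mirror_sym_def by blast
qed

text \<open>The gap at \<open>x\<close> is interior to a cable unless \<open>m\<close> divides
  \<open>x\<close>, and strands of one cable stay parallel whatever \<open>f\<close> is. Only the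
  boundaries between cables see \<open>f\<close>.\<close>

lemma cable_step:
  assumes "0 < m" "\<not> int m dvd x"
  shows "cable m f x < cable m f (x + 1)"
proof (rule strand_cases[OF assms(1), of x])
  fix q r
  assume x: "x = int m * (q - 1) + r" "1 \<le> r" "r \<le> int m"
  with assms(2) have "r < int m" by (cases "r = int m") auto
  then have "cable m f (int m * (q - 1) + (r + 1)) = int m * (f q - 1) + (r + 1)"
    using x by (intro cable_at) auto
  then show ?thesis using cable_at[OF x(2,3), of f q] by (simp add: x(1) add.assoc)
qed

lemma cable_step_dvd:
  assumes "0 < m" "f q < f (q + 1)"
  shows "cable m f (int m * q) < cable m f (int m * q + 1)"
proof -
  have "cable m f (int m * (q - 1) + int m) = int m * (f q - 1) + int m"
    using assms by (intro cable_at) auto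
  moreover have "cable m f (int m * (q + 1 - 1) + 1) = int m * (f (q + 1) - 1) + 1"
    using assms by (intro cable_at) auto
  moreover have "int m * f q \<le> int m * (f (q + 1) - 1)"
    using assms by (intro mult_left_mono) auto
  ultimately show ?thesis by (simp add: algebra_simps)
qed

text \<open>For \<open>s < n\<close> this is the block itself; for \<open>s = n\<close> the block is cut off at the centre \<open>n * m\<close>, and
  the mirror image restores the missing half. Both kinds of generators are thus handled uniformly.\<close>

definition band_nodes :: "nat \<Rightarrow> nat \<Rightarrow> nat \<Rightarrow> nat set" where
  "band_nodes m n s = block m s \<inter> {1..n * m}"

section \<open>Bands and the action of their longest elements\<close>

lemma band_nodes_iff:
  assumes "0 < m" "1 \<le> s"
  shows "j \<in> band_nodes m n s \<longleftrightarrow>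
    int m * (int s - 1) < int j \<and> int j < int m * (int s + 1) \<and> int j \<le> int n * int m"
proof -
  obtain s' where s': "s = Suc s'" using assms(2) by (cases s) auto
  have "j \<in> band_nodes m n s \<longleftrightarrow> s' * m < j \<and> j < (s' + 2) * m \<and> j \<le> n * m"
    using assms(1) by (auto simp: band_nodes_def block_def s')
  also have "\<dots> \<longleftrightarrow> int m * int s' < int j \<and> int j < int m * (int s' + 2) \<and> int j \<le> int n * int m"
  proof -
    have "int m * int s' = int (s' * m)" "int m * (int s' + 2) = int ((s' + 2) * m)"
      "int n * int m = int (n * m)" by (simp_all add: algebra_simps)
    then show ?thesis by (simp only: of_nat_less_iff of_nat_le_iff)
  qed
  finally show ?thesis by (simp add: s' algebra_simps)
qed

text \<open>The only cable boundary among the nodes of the band is \<open>s * m\<close>, where the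
  ascent of \<open>f\<close> at \<open>s\<close> is used; all other nodes are interior to a
  cable.\<close>

lemma cable_ascending_at:
  assumes "0 < m" "1 \<le> s" "f (int s) < f (int s + 1)" "j \<in> band_nodes m n s"
  shows "cable m f (int j) < cable m f (int j + 1)"
proof (cases "int m dvd int j")
  case True
  then obtain k where k: "int j = int m * k" by blast
  have "int s - 1 < k" "k < int s + 1"
    using assms k by (simp_all add: band_nodes_iff mult_less_cancel_left)
  then have "k = int s" by simp
  then show ?thesis using cable_step_dvd[OF assms(1,3)] k by simp
next
  case False
  then show ?thesis by (rule cable_step[OF assms(1)])
qed

text \<open>The gaps form two runs around the cable boundaries \<open>m * s\<close> and
  \<open>m * (2 * n - s)\<close>. For \<open>s = n\<close> both are the run around the centre, of
  which the truncated band supplies the centre and the lower half.\<close>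

lemma mirror_nodes_band:
  assumes m: "0 < m" and s: "1 \<le> s" "s \<le> n"
  shows "k \<in> mirror_nodes (n * m) (band_nodes m n s) \<longleftrightarrow>
    (\<exists>t\<in>{int s, 2 * int n - int s}. int m * (t - 1) < k \<and> k < int m * (t + 1))"
proof -
  let ?in = "\<lambda>k. int m * (int s - 1) < k \<and> k < int m * (int s + 1)"
  have swap: "?in (2 * int (n * m) - k) \<longleftrightarrow>
      int m * (2 * int n - int s - 1) < k \<and> k < int m * (2 * int n - int s + 1)" for k
    by (auto simp: algebra_simps)
  \<comment> \<open>The run reaches beyond the centre only for \<open>s = n\<close>, and then it is
    its own mirror image.\<close>
  have sym: "?in (2 * int (n * m) - k)" if "?in k" "int n * int m < k" for k
  proof -
    have "int m * int n < int m * (int s + 1)" using that by (simp add: mult.commute)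
    then have "int s = int n" using s(2) by (simp add: mult_less_cancel_left)
    then show ?thesis using that(1) by (simp add: algebra_simps)
  qed
  have low: "\<exists>j\<in>band_nodes m n s. k = int j" if "?in k" "k \<le> int n * int m" for k
  proof (intro bexI[of _ "nat k"])
    have "0 \<le> int m * (int s - 1)" using s(1) by simp
    then have "0 \<le> k" using that(1) by linarith
    then show "k = int (nat k)" "nat k \<in> band_nodes m n s"
      using that m s by (simp_all add: band_nodes_iff)
  qed
  have "k \<in> mirror_nodes (n * m) (band_nodes m n s) \<longleftrightarrow> ?in k \<or> ?in (2 * int (n * m) - k)"
  proof
    assume "k \<in> mirror_nodes (n * m) (band_nodes m n s)"
    then obtain j where "j \<in> band_nodes m n s" "k = int j \<or> k = 2 * int (n * m) - int j"
      by (auto simp: mirror_nodes_def)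
    then show "?in k \<or> ?in (2 * int (n * m) - k)"
      using m s by (auto simp: band_nodes_iff)
  next
    have main: "\<exists>j\<in>band_nodes m n s. k = int j \<or> 2 * int (n * m) - k = int j" if "?in k" for k
    proof (cases "k \<le> int n * int m")
      case True
      then show ?thesis using low[OF that] by blast
    next
      case False
      then have "?in (2 * int (n * m) - k)" "2 * int (n * m) - k \<le> int n * int m"
        using sym[OF that] by (auto simp: mult.commute)
      then show ?thesis using low by blast
    qed
    assume "?in k \<or> ?in (2 * int (n * m) - k)"
    then have "\<exists>j\<in>band_nodes m n s. k = int j \<or> 2 * int (n * m) - k = int j"
      using main[of k] main[of "2 * int (n * m) - k"] by force
    then show "k \<in> mirror_nodes (n * m) (band_nodes m n s)"
      by (force simp: mirror_nodes_def)
  qed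
  then show ?thesis unfolding swap by auto
qed

lemma mirror_nodes_Diff:
  assumes "1 \<le> s" "0 < m"
  shows "k \<in> mirror_nodes (n * m) (band_nodes m n s - {s * m}) \<longleftrightarrow>
    k \<in> mirror_nodes (n * m) (band_nodes m n s) \<and> \<not> int m dvd k"
proof -
  have dvd: "int m dvd int j \<longleftrightarrow> j = s * m" if "j \<in> band_nodes m n s" for j
  proof
    assume "int m dvd int j"
    then obtain l where l: "int j = int m * l" by blast
    have "int s - 1 < l" "l < int s + 1"
      using assms l that by (simp_all add: band_nodes_iff mult_less_cancel_left)
    then have "l = int s" by simp
    then have "int j = int (s * m)" using l by simp
    then show "j = s * m" by (simp only: of_nat_eq_iff)
  qed simp
  have dm: "int m dvd 2 * int (n * m) - j \<longleftrightarrow> int m dvd j" for j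
    by (rule dvd_diff_right_iff) simp
  show ?thesis
    using dvd dm unfolding mirror_nodes_def by auto
qed

text \<open>Removing \<open>s * m\<close> deletes the boundary in the middle of each run and leaves
  the interiors of the cables next to it: four cables, or two if \<open>s = n\<close>.\<close>

lemma mirror_nodes_band_Diff:
  assumes "0 < m" "1 \<le> s" "s \<le> n"
  shows "k \<in> mirror_nodes (n * m) (band_nodes m n s - {s * m}) \<longleftrightarrow>
    (\<exists>p\<in>{int s, int s + 1, 2 * int n - int s, 2 * int n - int s + 1}.
      int m * (p - 1) < k \<and> k < int m * p)"
proof -
  have *: "int m * (t - 1) < k \<and> k < int m * (t + 1) \<and> \<not> int m dvd k \<longleftrightarrow>
      (\<exists>p\<in>{t, t + 1}. int m * (p - 1) < k \<and> k < int m * p)" for t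
  proof -
    have le: "int m * (t - 1) \<le> int m * t" "int m * t \<le> int m * (t + 1)"
      by (intro mult_left_mono; simp)+
    have "\<not> int m dvd k" if "int m * (p - 1) < k" "k < int m * p" for p
    proof
      assume "int m dvd k"
      then obtain l where "k = int m * l" by blast
      then have "p - 1 < l" "l < p"
        using that assms(1) by (simp_all add: mult_less_cancel_left)
      then show False by simp
    qed
    moreover have "\<not> int m dvd k \<Longrightarrow> k \<noteq> int m * t" by auto
    ultimately show ?thesis using le by fastforce
  qed
  show ?thesis
    unfolding mirror_nodes_Diff[OF assms(2,1)] mirror_nodes_band[OF assms]
    using *[of "int s"] *[of "2 * int n - int s"] by auto
qed

text \<open>Each run of positions is a pair of neighbouring cables \<open>t\<close> and
  \<open>t + 1\<close>, reversed as a whole: cable \<open>q\<close> goes to cable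
  \<open>2 * t + 1 - q\<close>, and strand \<open>r\<close> to strand
  \<open>m + 1 - r\<close>.\<close>

lemma longest_band_act:
  assumes w: "longest_word (n * m) (band_nodes m n s) w" and m: "0 < m" and s: "1 \<le> s" "s \<le> n"
    and r: "1 \<le> r" "r \<le> int m"
  shows "t \<in> {int s, 2 * int n - int s} \<Longrightarrow> q \<in> {t, t + 1} \<Longrightarrow>
      act (n * m) w (int m * (q - 1) + r) = int m * (2 * t - q) + (int m + 1 - r)"
    and "q \<notin> {int s, int s + 1, 2 * int n - int s, 2 * int n - int s + 1} \<Longrightarrow>
      act (n * m) w (int m * (q - 1) + r) = int m * (q - 1) + r"
proof -
  have J: "band_nodes m n s \<subseteq> {..n * m}" by (auto simp: band_nodes_def)
  note mb = mirror_nodes_band[OF m s]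
  {
    assume t: "t \<in> {int s, 2 * int n - int s}" and q: "q \<in> {t, t + 1}"
    have no: "int m * (t + d) \<notin> mirror_nodes (n * m) (band_nodes m n s)" if "d \<in> {-1, 1}" for d
    proof
      assume "int m * (t + d) \<in> mirror_nodes (n * m) (band_nodes m n s)"
      then obtain t' where t': "t' \<in> {int s, 2 * int n - int s}"
        "int m * (t' - 1) < int m * (t + d)" "int m * (t + d) < int m * (t' + 1)"
        unfolding mb by blast
      then have "t' = t + d" using m by (simp add: mult_less_cancel_left)
      then have "t' - t = 1 \<or> t' - t = - 1" using that by auto
      \<comment> \<open>An end of one run inside another would put their centres at distance 1 in
        units of cables, but \<open>s\<close> and \<open>2 * n - s\<close> have the same
        parity.\<close>
      moreover have "even (t' - t)" using t t'(1) by auto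
      ultimately show False by presburger
    qed
    have le: "int m * (t - 1) + int m = int m * t" "int m * t + int m = int m * (t + 1)"
      by (simp_all add: algebra_simps)
    have "int m * (q - 1) = int m * (t - 1) \<or> int m * (q - 1) = int m * t" using q by auto
    then have x: "int m * (t - 1) + 1 \<le> int m * (q - 1) + r"
      "int m * (q - 1) + r \<le> int m * (t + 1)"
      using r le by linarith+
    have "{int m * (t - 1) + 1..<int m * (t + 1)} \<subseteq> mirror_nodes (n * m) (band_nodes m n s)"
      using t by (force simp: mb)
    from act_longest_word[OF w J this _ _ x] no[of "-1"] no[of 1]
    show "act (n * m) w (int m * (q - 1) + r) = int m * (2 * t - q) + (int m + 1 - r)"
      by (simp add: algebra_simps)
  next
    assume q: "q \<notin> {int s, int s + 1, 2 * int n - int s, 2 * int n - int s + 1}"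
    have no: "x \<notin> mirror_nodes (n * m) (band_nodes m n s)"
      if "int m * (q - 1) + r - 1 \<le> x" "x \<le> int m * (q - 1) + r" for x
    proof
      assume "x \<in> mirror_nodes (n * m) (band_nodes m n s)"
      then obtain t where t: "t \<in> {int s, 2 * int n - int s}"
        "int m * (t - 1) < x" "x < int m * (t + 1)"
        unfolding mb by blast
      then have "int m * (t - 1) < int m * (q - 1) + r" "\<not> int m * (t + 1) < int m * (q - 1) + r"
        using that by linarith+
      then have "t - 1 < q" "q \<le> t + 1" using less_strand_iff[OF r] by simp_all
      then show False using t(1) q by auto
    qed
    \<comment> \<open>The run consists of a single position, as neither adjacent gap is
      available.\<close>
    show "act (n * m) w (int m * (q - 1) + r) = int m * (q - 1) + r"
      using act_longest_word[OF w J _ no no order.refl order.refl] by simp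
  }
qed

text \<open>No gap at a cable boundary is available, so every cable is either reversed on its own or
  fixed. This serves both the band without its middle node and the flips.\<close>

lemma longest_blocks_act:
  assumes w: "longest_word N J w" and J: "J \<subseteq> {..N}" and m: "0 < m"
    and P: "\<And>k. k \<in> mirror_nodes N J \<longleftrightarrow> (\<exists>p\<in>P. int m * (p - 1) < k \<and> k < int m * p)"
    and r: "1 \<le> r" "r \<le> int m"
  shows "act N w (int m * (q - 1) + r) =
    int m * (q - 1) + (if q \<in> P then int m + 1 - r else r)"
proof (cases "q \<in> P")
  case True
  have no: "int m * l \<notin> mirror_nodes N J" for l
    using m unfolding P by (auto simp: mult_less_cancel_left)
  have le: "int m * (q - 1) + int m = int m * q" by (simp add: algebra_simps)
  have x: "int m * (q - 1) + 1 \<le> int m * (q - 1) + r" "int m * (q - 1) + r \<le> int m * q"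
    using r le by linarith+
  have "{int m * (q - 1) + 1..<int m * q} \<subseteq> mirror_nodes N J"
    using True by (force simp: P)
  from act_longest_word[OF w J this _ _ x] no[of "q - 1"] no[of q] True
  show ?thesis by (simp add: algebra_simps)
next
  case False
  have no: "x \<notin> mirror_nodes N J"
    if "int m * (q - 1) + r - 1 \<le> x" "x \<le> int m * (q - 1) + r" for x
  proof
    assume "x \<in> mirror_nodes N J"
    then obtain p where p: "p \<in> P" "int m * (p - 1) < x" "x < int m * p"
      unfolding P by blast
    then have "int m * (p - 1) < int m * (q - 1) + r" "\<not> int m * p < int m * (q - 1) + r"
      using that by linarith+
    then have "p - 1 < q" "q \<le> p" using less_strand_iff[OF r] by simp_all
    then have "q = p" by linarith
    then show False using p(1) False by simp
  qed
  show ?thesis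
    using act_longest_word[OF w J _ no no order.refl order.refl] False by simp
qed

lemma gen_band:
  assumes "s \<le> n"
  shows "t \<in> {int s, 2 * int n - int s} \<Longrightarrow> q \<in> {t, t + 1} \<Longrightarrow> gen n s q = 2 * t + 1 - q"
    and "q \<notin> {int s, int s + 1, 2 * int n - int s, 2 * int n - int s + 1} \<Longrightarrow> gen n s q = q"
proof -
  have e: "2 * int n - int s + 1 = 2 * int n + 1 - int s" by simp
  show "gen n s q = 2 * t + 1 - q" if t: "t \<in> {int s, 2 * int n - int s}" "q \<in> {t, t + 1}"
  proof -
    consider "t = int s" "q = int s" | "t = int s" "q = int s + 1"
      | "t = 2 * int n - int s" "q = 2 * int n - int s"
      | "t = 2 * int n - int s" "q = 2 * int n + 1 - int s"
      using t by (auto simp: e)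
    then show ?thesis using assms by cases simp_all
  qed
  show "gen n s q = q" if "q \<notin> {int s, int s + 1, 2 * int n - int s, 2 * int n - int s + 1}"
    using that by (intro gen_fixed) (simp add: e)
qed

text \<open>The longest element of the band exchanges two neighbouring cables and reverses each; the
  longest element without the middle node reverses each cable back. What remains exchanges cables
  with parallel strands.\<close>

lemma act_relative_longest_band:
  assumes m: "0 < m" and s: "1 \<le> s" "s \<le> n"
    and w: "longest_word (n * m) (band_nodes m n s) w"
    and v: "longest_word (n * m) (band_nodes m n s - {s * m}) v"
  shows "act (n * m) (v @ w) = cable m (gen n s)"
proof
  fix x
  obtain q r where x: "x = int m * (q - 1) + r" "1 \<le> r" "r \<le> int m"
    by (rule strand_cases[OF m])
  let ?P = "{int s, int s + 1, 2 * int n - int s, 2 * int n - int s + 1}"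
  have J: "band_nodes m n s - {s * m} \<subseteq> {..n * m}" by (auto simp: band_nodes_def)
  note v = longest_blocks_act[OF v J m mirror_nodes_band_Diff[OF m s]]
  have c: "cable m (gen n s) x = int m * (gen n s q - 1) + r"
    unfolding x(1) by (rule cable_at[OF x(2,3)])
  show "act (n * m) (v @ w) x = cable m (gen n s) x"
  proof (cases "q \<in> ?P")
    case True
    then obtain t where t: "t \<in> {int s, 2 * int n - int s}" "q \<in> {t, t + 1}" by blast
    have "act (n * m) w x = int m * (2 * t + 1 - q - 1) + (int m + 1 - r)"
      unfolding x(1) longest_band_act(1)[OF w m s x(2,3) t] by simp
    moreover have "2 * t + 1 - q \<in> ?P" using t by auto
    ultimately have "act (n * m) (v @ w) x = int m * (2 * t + 1 - q - 1) + r"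
      using v[of "int m + 1 - r" "2 * t + 1 - q"] x(2,3) by (simp add: act_append)
    then show ?thesis unfolding c gen_band(1)[OF s(2) t] .
  next
    case False
    then show ?thesis
      unfolding c gen_band(2)[OF s(2) False]
      using longest_band_act(2)[OF w m s x(2,3) False] v[OF x(2,3), of q]
      by (simp add: act_append x(1))
  qed
qed

section \<open>The node sets of flips\<close>

definition flip_nodes :: "nat \<Rightarrow> nat \<Rightarrow> nat set" where
  "flip_nodes m q = {(q - 1) * m + 1..q * m - 1}"

lemma flip_nodes_iff:
  assumes "0 < m" "1 \<le> q"
  shows "j \<in> flip_nodes m q \<longleftrightarrow> int m * (int q - 1) < int j \<and> int j < int m * int q"
proof -
  obtain q' where q': "q = Suc q'" using assms(2) by (cases q) auto
  have "j \<in> flip_nodes m q \<longleftrightarrow> q' * m < j \<and> j < (q' + 1) * m"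
    using assms(1) by (auto simp: flip_nodes_def q')
  moreover have "int m * int q' = int (q' * m)" "int m * (int q' + 1) = int ((q' + 1) * m)"
    by (simp_all add: algebra_simps)
  ultimately have "j \<in> flip_nodes m q \<longleftrightarrow> int m * int q' < int j \<and> int j < int m * (int q' + 1)"
    by (simp only: of_nat_less_iff of_nat_le_iff)
  then show ?thesis by (simp add: q' algebra_simps)
qed

lemma mirror_nodes_flip:
  assumes "0 < m" "1 \<le> q"
  shows "k \<in> mirror_nodes (n * m) (flip_nodes m q) \<longleftrightarrow>
    (\<exists>p\<in>{int q, 2 * int n + 1 - int q}. int m * (p - 1) < k \<and> k < int m * p)"
proof -
  let ?in = "\<lambda>k. int m * (int q - 1) < k \<and> k < int m * int q"
  have swap: "?in (2 * int (n * m) - k) \<longleftrightarrow>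
      int m * (2 * int n + 1 - int q - 1) < k \<and> k < int m * (2 * int n + 1 - int q)" for k
    by (auto simp: algebra_simps)
  have low: "\<exists>j\<in>flip_nodes m q. k = int j" if "?in k" for k
  proof (intro bexI[of _ "nat k"])
    have "0 \<le> int m * (int q - 1)" using assms(2) by simp
    then have "0 \<le> k" using that by linarith
    then show "k = int (nat k)" "nat k \<in> flip_nodes m q"
      using that assms by (simp_all add: flip_nodes_iff)
  qed
  have "k \<in> mirror_nodes (n * m) (flip_nodes m q) \<longleftrightarrow> ?in k \<or> ?in (2 * int (n * m) - k)"
  proof
    assume "k \<in> mirror_nodes (n * m) (flip_nodes m q)"
    then show "?in k \<or> ?in (2 * int (n * m) - k)"
      using assms by (auto simp: flip_nodes_iff mirror_nodes_def)
  next
    assume "?in k \<or> ?in (2 * int (n * m) - k)"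
    then show "k \<in> mirror_nodes (n * m) (flip_nodes m q)"
      using low[of k] low[of "2 * int (n * m) - k"] by (force simp: mirror_nodes_def)
  qed
  then show ?thesis unfolding swap by auto
qed

section \<open>Homomorphisms given on generators\<close>

lemma presented_hom_exists:
  assumes h: "\<And>i. i \<in> I \<Longrightarrow> h i \<in> lists I'"
    and rel: "\<And>x y. (x, y) \<in> R \<Longrightarrow> x \<in> lists I \<Longrightarrow> y \<in> lists I \<Longrightarrow>
      (concat (map h x), concat (map h y)) \<in> word_cong I' R'"
  shows "\<exists>\<Phi>\<in>monoid_hom (presented_monoid I R) (presented_monoid I' R').
    \<forall>u\<in>lists I. \<Phi> (word_cong I R `` {u}) = word_cong I' R' `` {concat (map h u)}"
proof -
  have l: "concat (map h u) \<in> lists I'" if "u \<in> lists I" for u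
    using that by (induction u rule: list.induct) (use h in auto)
  have cong: "(concat (map h u), concat (map h v)) \<in> word_cong I' R'"
    if "(u, v) \<in> word_cong I R" for u v
    using that
  proof (induction rule: word_cong.induct)
    case (rel x y u v)
    then show ?case
      using word_cong_context[OF assms(2)[OF rel(1-3)], of "concat (map h u)" "concat (map h v)"] l
      by simp
  next
    case (refl u)
    then show ?case using l by (intro word_cong.refl)
  next
    case (sym u v)
    from sym.IH show ?case by (rule word_cong.sym)
  next
    case (trans u v w)
    from trans.IH show ?case by (rule word_cong.trans)
  qed
  define \<Phi> where "\<Phi> X = (\<Union>u\<in>X. word_cong I' R' `` {concat (map h u)})" for X
  have \<Phi>: "\<Phi> (word_cong I R `` {u}) = word_cong I' R' `` {concat (map h u)}" if u: "u \<in> lists I" for u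
  proof -
    have "word_cong I' R' `` {concat (map h v)} = word_cong I' R' `` {concat (map h u)}"
      if "v \<in> word_cong I R `` {u}" for v
      using equiv_class_eq[OF equiv_word_cong cong[of u v]] that by simp
    moreover have "u \<in> word_cong I R `` {u}" using word_cong.refl[OF u] by simp
    ultimately show ?thesis unfolding \<Phi>_def by blast
  qed
  have "\<Phi> \<in> hom (presented_monoid I R) (presented_monoid I' R')"
  proof (rule homI)
    fix X
    assume "X \<in> carrier (presented_monoid I R)"
    then obtain u where "u \<in> lists I" "X = word_cong I R `` {u}"
      unfolding carrier_presented_monoid by blast
    then show "\<Phi> X \<in> carrier (presented_monoid I' R')"
      using \<Phi> l unfolding carrier_presented_monoid by auto
  next
    fix X Y
    assume "X \<in> carrier (presented_monoid I R)" "Y \<in> carrier (presented_monoid I R)"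
    then obtain u v where u: "u \<in> lists I" "X = word_cong I R `` {u}"
      and v: "v \<in> lists I" "Y = word_cong I R `` {v}"
      unfolding carrier_presented_monoid by blast
    have "u @ v \<in> lists I" using u v by simp
    then show "\<Phi> (X \<otimes>\<^bsub>presented_monoid I R\<^esub> Y) =
        \<Phi> X \<otimes>\<^bsub>presented_monoid I' R'\<^esub> \<Phi> Y"
      unfolding u(2) v(2) mult_presented_monoid[OF u(1) v(1)] \<Phi>[OF u(1)] \<Phi>[OF v(1)]
        mult_presented_monoid[OF l[OF u(1)] l[OF v(1)]]
      using \<Phi>[of "u @ v"] by simp
  qed
  moreover have "\<Phi> \<one>\<^bsub>presented_monoid I R\<^esub> = \<one>\<^bsub>presented_monoid I' R'\<^esub>"
    using \<Phi>[of "[]"] by (simp add: one_presented_monoid)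
  ultimately have "\<Phi> \<in> monoid_hom (presented_monoid I R) (presented_monoid I' R')"
    by (simp add: monoid_hom_def)
  then show ?thesis using \<Phi> by blast
qed

section \<open>Bands and flips\<close>

text \<open>\<open>fold_gen n s\<close> is the permutation induced by the generator \<open>s\<close> on the \<open>n\<close> pairs of
  mirror-symmetric cables.\<close>

definition fold_gen :: "nat \<Rightarrow> nat \<Rightarrow> nat \<Rightarrow> nat" where
  "fold_gen n s q = (if s < n then if q = s then s + 1 else if q = s + 1 then s else q else q)"

primrec fold_word :: "nat \<Rightarrow> nat list \<Rightarrow> nat \<Rightarrow> nat" where
  "fold_word n [] q = q"
| "fold_word n (s # w) q = fold_word n w (fold_gen n s q)"

text \<open>For \<open>s = n\<close> the two cables exchanged are \<open>n\<close> and its mirror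
  image \<open>n + 1\<close>, which a single flip reverses together.\<close>

definition band_flips :: "nat \<Rightarrow> nat \<Rightarrow> nat list" where
  "band_flips n s = (if s < n then [s, s + 1] else [s])"

text \<open>The flips that appear on the right when all flips contributed by the letters of a word are
  slid past the remaining letters.\<close>

primrec flips_after :: "nat \<Rightarrow> nat list \<Rightarrow> nat list" where
  "flips_after n [] = []"
| "flips_after n (s # w) = map (fold_word n w) (band_flips n s) @ flips_after n w"

lemma fold_gen_range: "s \<in> {1..n} \<Longrightarrow> q \<in> {1..n} \<Longrightarrow> fold_gen n s q \<in> {1..n}"
  by (auto simp: fold_gen_def)

lemma fold_word_range: "w \<in> lists {1..n} \<Longrightarrow> q \<in> {1..n} \<Longrightarrow> fold_word n w q \<in> {1..n}"
proof (induction w arbitrary: q rule: list.induct)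
  case (Cons s w)
  then have "fold_gen n s q \<in> {1..n}" by (intro fold_gen_range) simp_all
  then show ?case using Cons by simp
qed simp

lemma band_flips_range: "s \<in> {1..n} \<Longrightarrow> set (band_flips n s) \<subseteq> {1..n}"
  by (auto simp: band_flips_def)

lemma flips_after_range: "w \<in> lists {1..n} \<Longrightarrow> set (flips_after n w) \<subseteq> {1..n}"
proof (induction w rule: list.induct)
  case (Cons s w)
  then show ?case
    using band_flips_range[of s n] fold_word_range[of w n] by (auto simp del: atLeastAtMost_iff)
qed simp

text \<open>The flips per mirror pair of cables agree: for \<open>k = 2\<close> each pair involved
  is flipped once, for \<open>k = 3\<close> each of three pairs twice, for \<open>k = 4\<close> each
  of two pairs three times.\<close>

lemma mset_flips_alternating:
  assumes "s \<in> {1..n}" "t \<in> {1..n}" "s \<noteq> t" "entry (type_B n) s t = enat k"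
  shows "mset (flips_after n (alternating s t k)) = mset (flips_after n (alternating t s k))"
  using assms(1-3)
proof (cases rule: type_B_entry_cases)
qed (use assms in \<open>auto simp: numeral_eq_Suc band_flips_def fold_gen_def\<close>)

text \<open>\<open>gen n s\<close> commutes with the mirror, so it permutes mirror pairs; being an
  involution, it has equal images and preimages.\<close>

lemma fold_gen_gen:
  assumes "s \<in> {1..n}" "q \<in> {1..n}"
  shows "gen n s p \<in> {int q, 2 * int n + 1 - int q} \<longleftrightarrow>
    p \<in> {int (fold_gen n s q), 2 * int n + 1 - int (fold_gen n s q)}"
proof -
  have s: "s \<le> n" using assms by simp
  have g: "gen n s (int q) \<in> {int (fold_gen n s q), 2 * int n + 1 - int (fold_gen n s q)}"
    using assms by (auto simp: gen_def fold_gen_def)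
  have inv: "gen n s p = z \<longleftrightarrow> p = gen n s z" for z using gen_gen[OF s] by metis
  have "gen n s p \<in> {int q, 2 * int n + 1 - int q} \<longleftrightarrow>
      p \<in> {gen n s (int q), 2 * int n + 1 - gen n s (int q)}"
    unfolding insert_iff empty_iff inv gen_mirror[OF s] ..
  also have "{gen n s (int q), 2 * int n + 1 - gen n s (int q)} =
      {int (fold_gen n s q), 2 * int n + 1 - int (fold_gen n s q)}"
    using g by (elim insertE emptyE) auto
  finally show ?thesis .
qed

text \<open>The intended cases are \<open>rs = n - 1\<close> for type A and \<open>rs = n\<close>
  for type B. All nodes of bands and flips are at most \<open>n * m - 1\<close>, except the centre
  \<open>n * m\<close>, which occurs only in the band of \<open>n\<close>; \<open>rb_eq\<close>
  provides it in type B.\<close>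

locale cabling = small: sub_type_B Ms n rs + big: sub_type_B Mb "n * m" rb
  for Ms :: "nat coxeter_data" and n rs and Mb :: "nat coxeter_data" and m rb +
  assumes m_pos: "0 < m"
    and rb_ge: "n * m - 1 \<le> rb"
    and rb_eq: "rs = n \<Longrightarrow> rb = n * m"
begin

lemma band_nodes_sub:
  assumes "s \<in> nodes Ms"
  shows "band_nodes m n s \<subseteq> nodes Mb"
proof (cases "rs = n")
  case True
  then show ?thesis using rb_eq by (auto simp: band_nodes_def big.nodes_M)
next
  case False
  then have "s + 1 \<le> n" using assms small.r_le by (auto simp: small.nodes_M)
  then have "(s + 1) * m \<le> n * m" by (rule mult_le_mono1)
  then show ?thesis using rb_ge
    by (auto simp: band_nodes_def block_def big.nodes_M)
qed

lemma flip_nodes_sub: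
  assumes "q \<in> {1..n}"
  shows "flip_nodes m q \<subseteq> nodes Mb"
proof -
  have "q * m \<le> n * m" using assms by (intro mult_le_mono1) simp
  then have "q * m - 1 \<le> rb" using rb_ge by linarith
  then show ?thesis by (auto simp: flip_nodes_def big.nodes_M)
qed

section \<open>Words for bands and flips\<close>

definition full_band :: "nat \<Rightarrow> nat list" where
  "full_band s = (SOME w. longest_word (n * m) (band_nodes m n s) w)"

definition flip :: "nat \<Rightarrow> nat list" where
  "flip q = (SOME w. longest_word (n * m) (flip_nodes m q) w)"

text \<open>Confining the letters to the band keeps \<open>ascending_parabolic_id\<close> applicable
  from every base point that ascends on the band.\<close>

definition band :: "nat \<Rightarrow> nat list" where
  "band s = (SOME w. w \<in> lists (band_nodes m n s) \<and> ascending_word (n * m) w \<and>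
     act (n * m) w = cable m (gen n s))"

lemma full_band: "s \<in> nodes Ms \<Longrightarrow> longest_word (n * m) (band_nodes m n s) (full_band s)"
  unfolding full_band_def by (rule someI_ex) (metis big.longest_word_exists band_nodes_sub)

lemma flip: "q \<in> {1..n} \<Longrightarrow> longest_word (n * m) (flip_nodes m q) (flip q)"
  unfolding flip_def by (rule someI_ex) (metis big.longest_word_exists flip_nodes_sub)

lemma nodes_Ms: "s \<in> nodes Ms \<Longrightarrow> 1 \<le> s \<and> s \<le> n"
  using small.nodes_range by simp

text \<open>The concatenation of the two longest words has the right element but is in general not
  ascending; therefore \<open>band\<close> is chosen anew from its action.\<close>

lemma relative_longest_band:
  assumes s: "s \<in> nodes Ms"
  obtains v where "v \<in> lists (band_nodes m n s)" "act (n * m) v = cable m (gen n s)"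
    "relative_longest Mb (band_nodes m n s - {s * m}) (band_nodes m n s) = cox_class Mb v"
proof -
  have s': "1 \<le> s" "s \<le> n" using nodes_Ms[OF s] by auto
  have sub: "band_nodes m n s - {s * m} \<subseteq> nodes Mb" using band_nodes_sub[OF s] by blast
  obtain w where w: "longest_word (n * m) (band_nodes m n s) w"
    using big.longest_word_exists[OF band_nodes_sub[OF s]] .
  obtain v where v: "longest_word (n * m) (band_nodes m n s - {s * m}) v"
    using big.longest_word_exists[OF sub] .
  have l: "v \<in> lists (band_nodes m n s - {s * m})" "w \<in> lists (band_nodes m n s)"
    using v w by (auto simp: longest_word_def)
  have lb: "v \<in> lists (nodes Mb)" "w \<in> lists (nodes Mb)"
    using l lists_mono[OF sub] lists_mono[OF band_nodes_sub[OF s]] by blast+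
  have "relative_longest Mb (band_nodes m n s - {s * m}) (band_nodes m n s) = cox_class Mb (v @ w)"
    unfolding relative_longest_def big.longest_eq[OF sub v] big.longest_eq[OF band_nodes_sub[OF s] w]
    using mult_presented_monoid[OF lb] by (simp add: Cox_def cox_class_def)
  moreover have "v @ w \<in> lists (band_nodes m n s)" using l by auto
  ultimately show thesis
    using that act_relative_longest_band[OF m_pos s' w v] by blast
qed

lemma band:
  assumes s: "s \<in> nodes Ms"
  shows "band s \<in> lists (band_nodes m n s)" "ascending_word (n * m) (band s)"
    "act (n * m) (band s) = cable m (gen n s)"
proof -
  obtain v where v: "v \<in> lists (band_nodes m n s)" "act (n * m) v = cable m (gen n s)"
    using relative_longest_band[OF s] by metis
  have J: "band_nodes m n s \<subseteq> {..n * m}" by (auto simp: band_nodes_def)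
  have "\<exists>w. w \<in> lists (band_nodes m n s) \<and> ascending_word (n * m) w \<and>
     act (n * m) w = cable m (gen n s)"
    using ascending_word_exists[OF J v(1)] v(2) by metis
  from someI_ex[OF this]
  show "band s \<in> lists (band_nodes m n s)" "ascending_word (n * m) (band s)"
    "act (n * m) (band s) = cable m (gen n s)"
    by (fold band_def) auto
qed

lemma band_lists: "s \<in> nodes Ms \<Longrightarrow> band s \<in> lists (nodes Mb)"
  using band(1) lists_mono[OF band_nodes_sub] by blast

lemma full_band_lists: "s \<in> nodes Ms \<Longrightarrow> full_band s \<in> lists (nodes Mb)"
  using full_band lists_mono[OF band_nodes_sub] unfolding longest_word_def by blast

lemma flip_word:
  assumes "q \<in> {1..n}"
  shows "flip q \<in> lists (flip_nodes m q)" "ascending_word (n * m) (flip q)"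
  using flip[OF assms] by (auto simp: longest_word_def)

lemma flip_lists: "q \<in> {1..n} \<Longrightarrow> flip q \<in> lists (nodes Mb)"
  using flip_word lists_mono[OF flip_nodes_sub] by blast

lemma artin_lift_relative_longest_band:
  assumes s: "s \<in> nodes Ms"
  shows "artin_lift Mb (relative_longest Mb (band_nodes m n s - {s * m}) (band_nodes m n s)) =
    artin_class Mb (band s)"
proof -
  obtain v where v: "v \<in> lists (band_nodes m n s)" "act (n * m) v = cable m (gen n s)"
    "relative_longest Mb (band_nodes m n s - {s * m}) (band_nodes m n s) = cox_class Mb v"
    using relative_longest_band[OF s] .
  have "v \<in> lists (nodes Mb)" using v(1) lists_mono[OF band_nodes_sub[OF s]] by blast
  then show ?thesis
    unfolding v(3) using band[OF s] v(2) band_lists[OF s] by (intro big.artin_lift_eq) simp_all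
qed

lemma artin_lift_longest_band:
  assumes s: "s \<in> nodes Ms"
  shows "artin_lift Mb (longest Mb (band_nodes m n s)) = artin_class Mb (full_band s)"
  unfolding big.longest_eq[OF band_nodes_sub[OF s] full_band[OF s]]
  using full_band[OF s] full_band_lists[OF s]
  by (intro big.artin_lift_eq) (simp_all add: longest_word_def)

abbreviation bands :: "nat list \<Rightarrow> nat list" where
  "bands w \<equiv> concat (map band w)"

abbreviation full_bands :: "nat list \<Rightarrow> nat list" where
  "full_bands w \<equiv> concat (map full_band w)"

abbreviation flips :: "nat list \<Rightarrow> nat list" where
  "flips w \<equiv> concat (map flip w)"

lemma bands_lists: "w \<in> lists (nodes Ms) \<Longrightarrow> bands w \<in> lists (nodes Mb)"
  by (induction w rule: list.induct) (auto dest: band_lists)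

lemma flips_lists: "set w \<subseteq> {1..n} \<Longrightarrow> flips w \<in> lists (nodes Mb)"
  using flip_lists by (induction w) (simp_all del: atLeastAtMost_iff)

lemma act_bands:
  assumes "w \<in> lists (nodes Ms)"
  shows "act (n * m) (bands w) = cable m (act n w)"
  using assms
proof (induction w rule: list.induct)
  case Nil
  have "act n [] = (\<lambda>x. x)" by auto
  then show ?case by (intro ext) (simp add: cable_id[OF m_pos])
next
  case (Cons s w)
  show ?case
  proof
    fix x
    have "act (n * m) (bands (s # w)) x = cable m (gen n s) (cable m (act n w) x)"
      using Cons band(3)[of s] by (simp add: act_append)
    also have "\<dots> = cable m (\<lambda>x. gen n s (act n w x)) x" by (rule cable_cable[OF m_pos])
    also have "(\<lambda>x. gen n s (act n w x)) = act n (s # w)" by (intro ext) simp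
    finally show "act (n * m) (bands (s # w)) x = cable m (act n (s # w)) x" .
  qed
qed

text \<open>An ascent of \<open>f\<close> at \<open>s\<close> makes \<open>cable m f\<close> ascend
  at every node of the band, and from such a base point a word over the band ascends exactly when it
  does so from the identity.\<close>

lemma ascending_band:
  assumes "s \<in> nodes Ms" "mirror_sym n f" "f (int s) < f (int s + 1)"
  shows "ascending (n * m) (cable m f) (band s)"
proof -
  have "ascending (n * m) (cable m f) (band s) \<longleftrightarrow> ascending_word (n * m) (band s)"
  proof (rule ascending_parabolic_id)
    show "mirror_sym (n * m) (cable m f)" by (rule mirror_sym_cable[OF m_pos assms(2)])
    show "cable m f (int j) < cable m f (int j + 1)" if "j \<in> band_nodes m n s" for j
      using nodes_Ms[OF assms(1)] by (intro cable_ascending_at[OF m_pos _ assms(3) that]) simp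
    show "band_nodes m n s \<subseteq> {..n * m}" by (auto simp: band_nodes_def)
  qed (rule band(1)[OF assms(1)])
  then show ?thesis using band(2)[OF assms(1)] by simp
qed

lemma ascending_bands:
  assumes "w \<in> lists (nodes Ms)" "mirror_sym n f" "ascending n f w"
  shows "ascending (n * m) (cable m f) (bands w)"
  using assms
proof (induction w arbitrary: f rule: list.induct)
  case (Cons s w)
  then have s: "s \<in> nodes Ms" "s \<le> n" "w \<in> lists (nodes Ms)" using nodes_Ms by auto
  have "ascending (n * m) (cable m (\<lambda>x. f (gen n s x))) (bands w)"
    using Cons s by (intro Cons.IH mirror_sym_gen) simp_all
  moreover have "(\<lambda>x. cable m f (act (n * m) (band s) x)) = cable m (\<lambda>x. f (gen n s x))"
    by (intro ext) (simp add: band(3)[OF s(1)] cable_cable[OF m_pos])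
  ultimately show ?case
    using ascending_band[OF s(1) Cons.prems(2)] Cons.prems(3) by (simp add: ascending_append)
qed simp

lemma bands_cong:
  assumes "u \<in> lists (nodes Ms)" "v \<in> lists (nodes Ms)" "ascending_word n u" "ascending_word n v"
    "act n u = act n v"
  shows "(bands u, bands v) \<in> big.braid_cong"
proof -
  have c: "cable m (\<lambda>x. x) = (\<lambda>x. x)" by (intro ext) (rule cable_id[OF m_pos])
  note a = ascending_bands[OF _ mirror_sym_id, unfolded c]
  show ?thesis
    by (rule big.matsumoto[OF bands_lists[OF assms(1)] bands_lists[OF assms(2)]
        a[OF assms(1,3)] a[OF assms(2,4)]])
      (simp only: act_bands[OF assms(1)] act_bands[OF assms(2)] assms(5))
qed

lemma bands_alternating:
  assumes "s \<in> nodes Ms" "t \<in> nodes Ms" "s \<noteq> t" "entry Ms s t = enat k"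
  shows "(bands (alternating s t k), bands (alternating t s k)) \<in> big.braid_cong"
proof -
  have "s \<in> {1..rs}" "t \<in> {1..rs}" using assms(1,2) by (simp_all add: small.nodes_M)
  then have e: "entry (type_B n) s t = enat k" "entry (type_B n) t s = enat k"
    using assms(4) small.entry_M[of s t] small.entry_M[of t s] small.coxeter_M assms(1,2)
    by (auto simp: coxeter_matrix_def)
  note r = small.nodes_range[OF assms(1)] small.nodes_range[OF assms(2)]
  have "ascending_word n (alternating s t k)"
    using ascending_alternating[OF r assms(3) e(1) mirror_sym_id] by simp
  moreover have "ascending_word n (alternating t s k)"
    using ascending_alternating[OF r(2,1) assms(3)[symmetric] e(2) mirror_sym_id] by simp
  moreover have "act n (alternating s t k) = act n (alternating t s k)"
    using act_alternating[OF r assms(3) e(1)] by (intro ext)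
  ultimately show ?thesis
    using assms(1,2) by (intro bands_cong small.lists_alternating)
qed

section \<open>The homomorphism of Coxeter type\<close>

lemma hom_on_generators:
  assumes h: "\<And>s. s \<in> nodes Ms \<Longrightarrow> h s \<in> lists (nodes Mb)"
    and alt: "\<And>s t k. \<lbrakk>s \<in> nodes Ms; t \<in> nodes Ms; s \<noteq> t; entry Ms s t = enat k\<rbrakk> \<Longrightarrow>
      (concat (map h (alternating s t k)), concat (map h (alternating t s k))) \<in> big.braid_cong"
  shows "\<exists>\<Phi>\<in>monoid_hom (Artin Ms) (Artin Mb). \<forall>u\<in>lists (nodes Ms).
    \<Phi> (artin_class Ms u) = artin_class Mb (concat (map h u))"
proof -
  have rel: "(concat (map h x), concat (map h y)) \<in> big.braid_cong"
    if xy: "(x, y) \<in> braid_relations Ms" and "x \<in> lists (nodes Ms)" "y \<in> lists (nodes Ms)" for x y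
    using xy alt by (auto simp: braid_relations_def)
  have "\<exists>\<Phi>\<in>monoid_hom (presented_monoid (nodes Ms) (braid_relations Ms))
      (presented_monoid (nodes Mb) (braid_relations Mb)). \<forall>u\<in>lists (nodes Ms).
      \<Phi> (small.braid_cong `` {u}) = big.braid_cong `` {concat (map h u)}"
    by (rule presented_hom_exists) (fact h, fact rel)
  then show ?thesis by (simp only: Artin_def artin_class_def)
qed

text \<open>Cabling respects composition, so words with equal action have bands with equal action;
  faithfulness for the big diagram converts this into Coxeter congruence.\<close>

lemma bands_cox_relation:
  assumes "(x, y) \<in> coxeter_relations Ms" "x \<in> lists (nodes Ms)" "y \<in> lists (nodes Ms)"
  shows "(bands x, bands y) \<in> big.cox_cong"
proof -
  have "(x, y) \<in> small.cox_cong"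
    using word_cong.rel[OF assms, of "[]" "[]"] by simp
  then have "act n x = act n y" by (rule small.cox_act)
  then show ?thesis
    unfolding big.cox_cong_iff[OF bands_lists[OF assms(2)] bands_lists[OF assms(3)]]
    by (simp only: act_bands[OF assms(2)] act_bands[OF assms(3)])
qed

theorem coxeter_type_cabling:
  obtains \<Phi> where "coxeter_type_hom Ms Mb \<Phi>"
    "\<And>s. s \<in> nodes Ms \<Longrightarrow> \<Phi> (artin_gen Ms s) =
      artin_lift Mb (relative_longest Mb (band_nodes m n s - {s * m}) (band_nodes m n s))"
proof -
  have "\<exists>\<Phi>\<in>monoid_hom (Artin Ms) (Artin Mb). \<forall>u\<in>lists (nodes Ms).
      \<Phi> (artin_class Ms u) = artin_class Mb (bands u)"
    by (rule hom_on_generators[of band]) (fact band_lists, fact bands_alternating)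
  then obtain \<Phi> where \<Phi>: "\<Phi> \<in> monoid_hom (Artin Ms) (Artin Mb)"
    "\<And>u. u \<in> lists (nodes Ms) \<Longrightarrow> \<Phi> (artin_class Ms u) = artin_class Mb (bands u)"
    by blast
  have "\<exists>\<phi>\<in>monoid_hom (presented_monoid (nodes Ms) (coxeter_relations Ms))
      (presented_monoid (nodes Mb) (coxeter_relations Mb)). \<forall>u\<in>lists (nodes Ms).
      \<phi> (small.cox_cong `` {u}) = big.cox_cong `` {bands u}"
    by (rule presented_hom_exists) (fact band_lists, fact bands_cox_relation)
  then obtain \<phi> where \<phi>: "\<phi> \<in> monoid_hom (presented_monoid (nodes Ms) (coxeter_relations Ms))
      (presented_monoid (nodes Mb) (coxeter_relations Mb))"
    "\<And>u. u \<in> lists (nodes Ms) \<Longrightarrow> \<phi> (small.cox_cong `` {u}) = big.cox_cong `` {bands u}"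
    by blast
  \<comment> \<open>Both homomorphisms send the class of \<open>u\<close> to the class of
    \<open>bands u\<close>, so the compatibility can be checked on words.\<close>
  have "\<phi> (artin_to_cox Ms x) = artin_to_cox Mb (\<Phi> x)" if "x \<in> carrier (Artin Ms)" for x
  proof -
    have "x \<in> artin_class Ms ` lists (nodes Ms)"
      using that by (simp only: Artin_def artin_class_def[abs_def] carrier_presented_monoid)
    then obtain u where u: "u \<in> lists (nodes Ms)" "x = artin_class Ms u" by (elim imageE)
    have "\<phi> (artin_to_cox Ms x) = cox_class Mb (bands u)"
      using \<phi>(2)[OF u(1)] by (simp only: u(2) artin_to_cox_class[OF small.coxeter_M u(1)] cox_class_def)
    also have "\<dots> = artin_to_cox Mb (\<Phi> x)"
      by (simp only: u(2) \<Phi>(2)[OF u(1)] artin_to_cox_class[OF big.coxeter_M bands_lists[OF u(1)]])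
    finally show ?thesis .
  qed
  moreover have "\<phi> \<in> hom (Cox Ms) (Cox Mb)" using \<phi>(1) by (simp add: Cox_def monoid_hom_def)
  ultimately have "coxeter_type_hom Ms Mb \<Phi>"
    unfolding coxeter_type_hom_def using \<Phi>(1) by blast
  moreover have "\<Phi> (artin_gen Ms s) =
      artin_lift Mb (relative_longest Mb (band_nodes m n s - {s * m}) (band_nodes m n s))"
    if "s \<in> nodes Ms" for s
    using \<Phi>(2)[of "[s]"] that by (simp add: artin_gen_def artin_lift_relative_longest_band)
  ultimately show thesis by (rule that)
qed

section \<open>Relations between flips and bands\<close>

lemma act_flip:
  assumes "q \<in> {1..n}" "1 \<le> r" "r \<le> int m"
  shows "act (n * m) (flip q) (int m * (p - 1) + r) =
    int m * (p - 1) + (if p \<in> {int q, 2 * int n + 1 - int q} then int m + 1 - r else r)"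
proof (rule longest_blocks_act[OF flip[OF assms(1)] _ m_pos _ assms(2,3)])
  show "flip_nodes m q \<subseteq> {..n * m}"
    using flip_nodes_sub[OF assms(1)] big.nodes_le by blast
  show "k \<in> mirror_nodes (n * m) (flip_nodes m q) \<longleftrightarrow>
    (\<exists>p\<in>{int q, 2 * int n + 1 - int q}. int m * (p - 1) < k \<and> k < int m * p)" for k
    using assms(1) by (intro mirror_nodes_flip[OF m_pos]) simp
qed

lemma ascending_flip_nodes:
  assumes "q \<in> {1..n}" "v \<in> lists (flip_nodes m q)" "ascending_word (n * m) v"
    "mirror_sym (n * m) f" "\<And>j. j \<in> flip_nodes m q \<Longrightarrow> f (int j) < f (int j + 1)"
  shows "ascending (n * m) f v"
proof -
  have "flip_nodes m q \<subseteq> {..n * m}"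
    using flip_nodes_sub[OF assms(1)] big.nodes_le by blast
  from ascending_parabolic_id[OF assms(4,5) this assms(2)] assms(3) show ?thesis by simp
qed

lemma flip_nodes_strand:
  assumes "q \<in> {1..n}" "j \<in> flip_nodes m q"
  obtains r where "int j = int m * (int q - 1) + r" "int j + 1 = int m * (int q - 1) + (r + 1)"
    "1 \<le> r" "r + 1 \<le> int m"
proof (rule that[of "int j - int m * (int q - 1)"])
  have "int m * (int q - 1) + int m = int m * int q" by (simp add: algebra_simps)
  then show "1 \<le> int j - int m * (int q - 1)" "int j - int m * (int q - 1) + 1 \<le> int m"
    using assms flip_nodes_iff[OF m_pos, of q j] by auto
qed simp_all

lemma cable_ascending_flip_nodes:
  assumes "q \<in> {1..n}" "j \<in> flip_nodes m q"
  shows "cable m f (int j) < cable m f (int j + 1)"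
proof -
  obtain r where r: "int j = int m * (int q - 1) + r" "int j + 1 = int m * (int q - 1) + (r + 1)"
    "1 \<le> r" "r + 1 \<le> int m"
    using flip_nodes_strand[OF assms] .
  then have "cable m f (int m * (int q - 1) + r) = int m * (f (int q) - 1) + r"
    "cable m f (int m * (int q - 1) + (r + 1)) = int m * (f (int q) - 1) + (r + 1)"
    by (intro cable_at; simp)+
  then show ?thesis unfolding r(1,2)[symmetric] by linarith
qed

text \<open>Different flips move disjoint sets of cables, so the ascents of \<open>f\<close> at the
  nodes of later flips survive the earlier ones. A second flip of the same cable would undo the
  first.\<close>

lemma ascending_flips:
  assumes "distinct w" "set w \<subseteq> {1..n}" "mirror_sym (n * m) f"
    "\<And>q j. q \<in> set w \<Longrightarrow> j \<in> flip_nodes m q \<Longrightarrow> f (int j) < f (int j + 1)"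
  shows "ascending (n * m) f (flips w)"
  using assms
proof (induction w arbitrary: f)
  case (Cons q w)
  have q: "q \<in> {1..n}" "q \<notin> set w" using Cons.prems by auto
  have "ascending (n * m) f (flip q)"
    by (rule ascending_flip_nodes[OF q(1) flip_word[OF q(1)] Cons.prems(3,4)]) simp_all
  moreover have "ascending (n * m) (\<lambda>x. f (act (n * m) (flip q) x)) (flips w)"
  proof (rule Cons.IH)
    show "mirror_sym (n * m) (\<lambda>x. f (act (n * m) (flip q) x))"
      using Cons.prems(3) big.words_le[OF flip_lists[OF q(1)]] by (rule mirror_sym_act)
    fix q' j
    assume q': "q' \<in> set w" "j \<in> flip_nodes m q'"
    then have q'n: "q' \<in> {1..n}" "q' \<noteq> q" using Cons.prems q by auto
    obtain r where r: "int j = int m * (int q' - 1) + r" "int j + 1 = int m * (int q' - 1) + (r + 1)"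
      "1 \<le> r" "r + 1 \<le> int m"
      using flip_nodes_strand[OF q'n(1) q'(2)] .
    \<comment> \<open>The mirror cable of \<open>q\<close> lies above \<open>n\<close>, while
      \<open>q'\<close> is at most \<open>n\<close>.\<close>
    have ne: "int q' \<notin> {int q, 2 * int n + 1 - int q}" using q q'n by auto
    have "act (n * m) (flip q) (int j) = int j"
      unfolding r(1) using act_flip[OF q(1), of r "int q'"] r(3,4) ne by simp
    moreover have "act (n * m) (flip q) (int j + 1) = int j + 1"
      unfolding r(2) using act_flip[OF q(1), of "r + 1" "int q'"] r(3,4) ne by simp
    ultimately show "f (act (n * m) (flip q) (int j)) < f (act (n * m) (flip q) (int j + 1))"
      using Cons.prems(4)[of q' j] q' by simp
  qed (use Cons.prems in auto)
  ultimately show ?case by (simp add: ascending_append)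
qed simp

lemma flip_commute:
  assumes "q \<in> {1..n}" "q' \<in> {1..n}"
  shows "(flip q @ flip q', flip q' @ flip q) \<in> big.braid_cong"
proof (cases "q = q'")
  case True
  show ?thesis
    unfolding True[symmetric] using flip_lists[OF assms(1)] by (intro word_cong.refl) simp
next
  case False
  have a: "ascending_word (n * m) (flip p @ flip p')"
    if "p \<in> {1..n}" "p' \<in> {1..n}" "p \<noteq> p'" for p p'
    using ascending_flips[of "[p, p']" "\<lambda>x. x"] that by (simp add: mirror_sym_id)
  show ?thesis
  proof (rule big.matsumoto)
    show "act (n * m) (flip q @ flip q') = act (n * m) (flip q' @ flip q)"
    proof
      fix x
      obtain p r where x: "x = int m * (p - 1) + r" "1 \<le> r" "r \<le> int m"
        by (rule strand_cases[OF m_pos])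
      have r': "1 \<le> int m + 1 - r" "int m + 1 - r \<le> int m" using x by auto
      have inv: "int m + 1 - (int m + 1 - r) = r" by simp
      show "act (n * m) (flip q @ flip q') x = act (n * m) (flip q' @ flip q) x"
        using act_flip[OF assms(1) x(2,3)] act_flip[OF assms(1) r']
          act_flip[OF assms(2) x(2,3)] act_flip[OF assms(2) r']
        unfolding x(1) act_append
        by (cases "p \<in> {int q, 2 * int n + 1 - int q}";
            cases "p \<in> {int q', 2 * int n + 1 - int q'}") (simp_all only: if_True if_False inv simp_thms)
    qed
  qed (use a assms False flip_lists in \<open>simp_all del: atLeastAtMost_iff\<close>)
qed

text \<open>Reversing a cable after the cables are permuted is the same as reversing beforehand the
  cable that arrives there; up to mirror images this is cable \<open>fold_gen n s q\<close>.\<close>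

lemma flip_band:
  assumes s: "s \<in> nodes Ms" and q: "q \<in> {1..n}"
  shows "(flip q @ band s, band s @ flip (fold_gen n s q)) \<in> big.braid_cong"
proof (rule big.matsumoto)
  have s': "s \<in> {1..n}" "s \<le> n" using nodes_Ms[OF s] by auto
  have q': "fold_gen n s q \<in> {1..n}" by (rule fold_gen_range[OF s'(1) q])
  note bl = band_lists[OF s] and fl = flip_lists[OF q]
  show "flip q @ band s \<in> lists (nodes Mb)" "band s @ flip (fold_gen n s q) \<in> lists (nodes Mb)"
    using bl fl flip_lists[OF q'] by simp_all
  have sy: "mirror_sym (n * m) (cable m (gen n s))"
    using mirror_sym_gen[OF mirror_sym_id s'(2)] by (intro mirror_sym_cable m_pos) simp
  have "ascending (n * m) (cable m (gen n s)) (flip (fold_gen n s q))"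
    by (rule ascending_flip_nodes[OF q' flip_word[OF q'] sy cable_ascending_flip_nodes[OF q']])
  then show "ascending_word (n * m) (band s @ flip (fold_gen n s q))"
    using band(2,3)[OF s] by (simp add: ascending_append)
  \<comment> \<open>After \<open>flip q\<close> the permutation may fail to ascend at the nodes of
    the band, so \<open>flip q @ band s\<close> is treated through its reverse:
    \<open>rev (band s)\<close> also acts as \<open>cable m (gen n s)\<close>, which ascends at the
    nodes of the flip.\<close>
  have rf: "rev (flip q) \<in> lists (flip_nodes m q)" "ascending_word (n * m) (rev (flip q))"
    using flip_word[OF q] big.ascending_word_rev[OF fl] by (simp_all add: in_lists_conv_set)
  have "act (n * m) (rev (band s)) x = cable m (gen n s) x" for x
  proof -
    have "act (n * m) (band s) (cable m (gen n s) x) = x"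
      by (simp add: band(3)[OF s] cable_cable[OF m_pos] gen_gen[OF s'(2)] cable_id[OF m_pos])
    then show ?thesis using act_rev[OF big.words_le[OF bl]] by metis
  qed
  then have "(\<lambda>x. act (n * m) (rev (band s)) x) = cable m (gen n s)" by (intro ext)
  moreover have "ascending (n * m) (cable m (gen n s)) (rev (flip q))"
    by (rule ascending_flip_nodes[OF q rf sy cable_ascending_flip_nodes[OF q]])
  ultimately have "ascending_word (n * m) (rev (band s) @ rev (flip q))"
    using big.ascending_word_rev[OF bl band(2)[OF s]] by (simp add: ascending_append)
  moreover have "rev (band s) @ rev (flip q) \<in> lists (nodes Mb)"
    using bl fl by (simp add: in_lists_conv_set ball_Un)
  ultimately show "ascending_word (n * m) (flip q @ band s)"
    using big.ascending_word_rev[of "rev (band s) @ rev (flip q)"] by simp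
  show "act (n * m) (flip q @ band s) = act (n * m) (band s @ flip (fold_gen n s q))"
  proof
    fix x
    obtain p r where x: "x = int m * (p - 1) + r" "1 \<le> r" "r \<le> int m"
      by (rule strand_cases[OF m_pos])
    let ?c = "\<lambda>b. if b then int m + 1 - r else r"
    have c: "1 \<le> ?c b" "?c b \<le> int m" for b using x by auto
    have "act (n * m) (flip q @ band s) x = act (n * m) (flip q) (int m * (gen n s p - 1) + r)"
      by (simp only: act_append band(3)[OF s] x(1) cable_at[OF x(2,3)])
    also have "\<dots> = int m * (gen n s p - 1) + ?c (gen n s p \<in> {int q, 2 * int n + 1 - int q})"
      by (rule act_flip[OF q x(2,3)])
    also have "\<dots> = cable m (gen n s) (int m * (p - 1) +
        ?c (p \<in> {int (fold_gen n s q), 2 * int n + 1 - int (fold_gen n s q)}))"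
      unfolding fold_gen_gen[OF s'(1) q] by (rule cable_at[OF c, symmetric])
    also have "\<dots> = act (n * m) (band s @ flip (fold_gen n s q)) x"
      by (simp only: act_append band(3)[OF s] x(1) act_flip[OF q' x(2,3)])
    finally show "act (n * m) (flip q @ band s) x = act (n * m) (band s @ flip (fold_gen n s q)) x" .
  qed
qed

text \<open>The flips, standing on the right and hence acting first, reverse each cable concerned;
  the band then exchanges the cables with parallel strands. Together this reverses each pair of
  neighbouring cables as a whole.\<close>

lemma full_band_cong:
  assumes s: "s \<in> nodes Ms"
  shows "(full_band s, band s @ flips (band_flips n s)) \<in> big.braid_cong"
proof (rule big.matsumoto)
  have s': "1 \<le> s" "s \<le> n" "s \<in> {1..n}" using nodes_Ms[OF s] by auto
  have bf: "set (band_flips n s) \<subseteq> {1..n}" "distinct (band_flips n s)"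
    using band_flips_range[OF s'(3)] by (auto simp: band_flips_def)
  show "full_band s \<in> lists (nodes Mb)" by (rule full_band_lists[OF s])
  show "band s @ flips (band_flips n s) \<in> lists (nodes Mb)"
    using band_lists[OF s] flips_lists[OF bf(1)] by simp
  show "ascending_word (n * m) (full_band s)" using full_band[OF s] by (simp add: longest_word_def)
  have sy: "mirror_sym (n * m) (cable m (gen n s))"
    using mirror_sym_gen[OF mirror_sym_id s'(2)] by (intro mirror_sym_cable m_pos) simp
  have "ascending (n * m) (cable m (gen n s)) (flips (band_flips n s))"
    using bf sy by (intro ascending_flips cable_ascending_flip_nodes) auto
  then show "ascending_word (n * m) (band s @ flips (band_flips n s))"
    using band(2,3)[OF s] by (simp add: ascending_append)
  show "act (n * m) (full_band s) = act (n * m) (band s @ flips (band_flips n s))"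
  proof
    fix x
    obtain p r where x: "x = int m * (p - 1) + r" "1 \<le> r" "r \<le> int m"
      by (rule strand_cases[OF m_pos])
    let ?P = "{int s, int s + 1, 2 * int n - int s, 2 * int n - int s + 1}"
    let ?r = "if p \<in> ?P then int m + 1 - r else r"
    have r': "1 \<le> int m + 1 - r" "int m + 1 - r \<le> int m" using x by auto
    \<comment> \<open>For \<open>s < n\<close> the flips of \<open>s\<close> and
      \<open>s + 1\<close> reach, with the mirror images, the four cables in \<open>?P\<close>; for
      \<open>s = n\<close> these are just \<open>n\<close> and \<open>n + 1\<close>.\<close>
    have "act (n * m) (flips (band_flips n s)) x = int m * (p - 1) + ?r"
    proof (cases "s < n")
      case True
      then have s1: "s + 1 \<in> {1..n}" by simp
      show ?thesis
        using True act_flip[OF s'(3) x(2,3), of p] act_flip[OF s1 x(2,3), of p]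
          act_flip[OF s'(3) r', of p]
        by (auto simp: band_flips_def act_append x(1))
    next
      case False
      then have "s = n" using s' by simp
      then show ?thesis
        using act_flip[OF s'(3) x(2,3), of p] by (auto simp: band_flips_def x(1))
    qed
    then have b: "act (n * m) (band s @ flips (band_flips n s)) x = int m * (gen n s p - 1) + ?r"
      using x(2,3) cable_at[of ?r m "gen n s" p] by (auto simp: act_append band(3)[OF s])
    show "act (n * m) (full_band s) x = act (n * m) (band s @ flips (band_flips n s)) x"
    proof (cases "p \<in> ?P")
      case True
      then obtain t where t: "t \<in> {int s, 2 * int n - int s}" "p \<in> {t, t + 1}" by blast
      have "act (n * m) (full_band s) x = int m * (2 * t - p) + (int m + 1 - r)"
        unfolding x(1) by (rule longest_band_act(1)[OF full_band[OF s] m_pos s'(1,2) x(2,3) t])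
      then show ?thesis unfolding b gen_band(1)[OF s'(2) t] using True by simp
    next
      case False
      have "act (n * m) (full_band s) x = int m * (p - 1) + r"
        unfolding x(1) by (rule longest_band_act(2)[OF full_band[OF s] m_pos s'(1,2) x(2,3) False])
      then show ?thesis unfolding b gen_band(2)[OF s'(2) False] using False by simp
    qed
  qed
qed

lemma flip_bands:
  assumes "w \<in> lists (nodes Ms)" "q \<in> {1..n}"
  shows "(flip q @ bands w, bands w @ flip (fold_word n w q)) \<in> big.braid_cong"
  using assms
proof (induction w arbitrary: q rule: list.induct)
  case Nil
  then show ?case using flip_lists by (auto intro!: word_cong.refl simp del: atLeastAtMost_iff)
next
  case (Cons s w)
  then have s: "s \<in> nodes Ms" "w \<in> lists (nodes Ms)" by auto
  then have q': "fold_gen n s q \<in> {1..n}" using Cons.prems small.nodes_range fold_gen_range by blast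
  have "((flip q @ band s) @ bands w, (band s @ flip (fold_gen n s q)) @ bands w) \<in> big.braid_cong"
    by (intro word_cong_append flip_band s Cons.prems(2) word_cong.refl bands_lists)
  moreover have "(band s @ (flip (fold_gen n s q) @ bands w),
      band s @ (bands w @ flip (fold_word n w (fold_gen n s q)))) \<in> big.braid_cong"
    by (intro word_cong_append word_cong.refl band_lists s Cons.IH q')
  ultimately show ?case by (auto intro: word_cong.trans)
qed

lemma flips_bands:
  assumes "w \<in> lists (nodes Ms)" "set qs \<subseteq> {1..n}"
  shows "(flips qs @ bands w, bands w @ flips (map (fold_word n w) qs)) \<in> big.braid_cong"
  using assms(2)
proof (induction qs)
  case Nil
  then show ?case using bands_lists[OF assms(1)] by (simp add: word_cong.refl)
next
  case (Cons q qs)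
  then have q: "q \<in> {1..n}" "set qs \<subseteq> {1..n}" by auto
  have "w \<in> lists {1..n}" using assms(1) small.nodes_range by auto
  then have r: "set (map (fold_word n w) qs) \<subseteq> {1..n}" using q(2) fold_word_range by fastforce
  have "(flip q @ (flips qs @ bands w), flip q @ (bands w @ flips (map (fold_word n w) qs)))
      \<in> big.braid_cong"
    by (intro word_cong_append word_cong.refl flip_lists Cons.IH q)
  moreover have "((flip q @ bands w) @ flips (map (fold_word n w) qs),
      (bands w @ flip (fold_word n w q)) @ flips (map (fold_word n w) qs)) \<in> big.braid_cong"
    by (intro word_cong_append word_cong.refl flips_lists flip_bands assms(1) q r)
  ultimately show ?case by (auto intro: word_cong.trans)
qed

lemma full_bands_cong:
  assumes "w \<in> lists (nodes Ms)"
  shows "(full_bands w, bands w @ flips (flips_after n w)) \<in> big.braid_cong"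
  using assms
proof (induction w rule: list.induct)
  case Nil
  then show ?case by (simp add: word_cong.refl)
next
  case (Cons s w)
  then have s: "s \<in> nodes Ms" "w \<in> lists (nodes Ms)" by auto
  have wn: "w \<in> lists {1..n}" using s(2) small.nodes_range by auto
  let ?E = "band_flips n s" and ?L = "flips_after n w"
  have E: "set ?E \<subseteq> {1..n}" using band_flips_range small.nodes_range[OF s(1)] by blast
  have L: "flips ?L \<in> lists (nodes Mb)" by (rule flips_lists[OF flips_after_range[OF wn]])
  have 1: "(full_band s @ full_bands w, (band s @ flips ?E) @ (bands w @ flips ?L)) \<in> big.braid_cong"
    by (intro word_cong_append full_band_cong s Cons.IH)
  have 2: "(band s @ (flips ?E @ bands w) @ flips ?L,
      band s @ (bands w @ flips (map (fold_word n w) ?E)) @ flips ?L) \<in> big.braid_cong"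
    by (intro word_cong_context flips_bands s E band_lists L)
  show ?case using word_cong.trans[OF 1] 2 by simp
qed

text \<open>Flips commute, so each one can be moved to the place it has in
  \<open>ys\<close>.\<close>

lemma flips_mset_cong:
  assumes "mset xs = mset ys" "set xs \<subseteq> {1..n}"
  shows "(flips xs, flips ys) \<in> big.braid_cong"
  using assms
proof (induction xs arbitrary: ys)
  case Nil
  then show ?case by (simp add: word_cong.refl)
next
  case (Cons x xs)
  have x: "x \<in> {1..n}" "set xs \<subseteq> {1..n}" using Cons.prems by auto
  have "x \<in> set ys" using Cons.prems(1) by (metis list.set_intros(1) mset_eq_setD)
  then obtain as bs where ys: "ys = as @ x # bs" by (meson split_list)
  then have xs: "mset xs = mset (as @ bs)" using Cons.prems(1) by simp
  then have ab: "set as \<subseteq> {1..n}" "set bs \<subseteq> {1..n}" using x(2) mset_eq_setD by fastforce+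
  have move: "(flip x @ flips as, flips as @ flip x) \<in> big.braid_cong"
    using ab(1)
  proof (induction as)
    case Nil
    then show ?case using flip_lists[OF x(1)] by (simp add: word_cong.refl)
  next
    case (Cons a as)
    then have a: "a \<in> {1..n}" "set as \<subseteq> {1..n}" by auto
    have "((flip x @ flip a) @ flips as, (flip a @ flip x) @ flips as) \<in> big.braid_cong"
      by (intro word_cong_append flip_commute word_cong.refl flips_lists x a)
    moreover have "(flip a @ (flip x @ flips as), flip a @ (flips as @ flip x)) \<in> big.braid_cong"
      by (intro word_cong_append word_cong.refl flip_lists a Cons.IH)
    ultimately show ?case by (auto intro: word_cong.trans)
  qed
  have "(flip x @ flips xs, flip x @ flips (as @ bs)) \<in> big.braid_cong"
    by (intro word_cong_append word_cong.refl flip_lists x Cons.IH xs)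
  moreover have "((flip x @ flips as) @ flips bs, (flips as @ flip x) @ flips bs) \<in> big.braid_cong"
    by (intro word_cong_append word_cong.refl move flips_lists ab)
  ultimately show ?case unfolding ys by (auto intro: word_cong.trans)
qed

lemma full_bands_alternating:
  assumes "s \<in> nodes Ms" "t \<in> nodes Ms" "s \<noteq> t" "entry Ms s t = enat k"
  shows "(full_bands (alternating s t k), full_bands (alternating t s k)) \<in> big.braid_cong"
proof -
  have l: "alternating s t k \<in> lists (nodes Ms)" "alternating t s k \<in> lists (nodes Ms)"
    by (rule small.lists_alternating[OF assms(1,2)], rule small.lists_alternating[OF assms(2,1)])
  have n: "alternating s t k \<in> lists {1..n}" using l(1) small.nodes_range by auto
  have "entry (type_B n) s t = enat k"
    using assms small.entry_M[of s t] by (simp add: small.nodes_M)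
  then have "mset (flips_after n (alternating s t k)) = mset (flips_after n (alternating t s k))"
    using small.nodes_range assms(1-3) by (intro mset_flips_alternating)
  then have "(flips (flips_after n (alternating s t k)), flips (flips_after n (alternating t s k)))
      \<in> big.braid_cong"
    using flips_after_range[OF n] by (rule flips_mset_cong)
  from word_cong_append[OF bands_alternating[OF assms] this]
  show ?thesis
    using full_bands_cong[OF l(1)] word_cong.sym[OF full_bands_cong[OF l(2)]]
    by (blast intro: word_cong.trans)
qed

theorem standard_cabling:
  obtains \<Phi> where "standard_hom Ms Mb \<Phi>"
    "\<And>s. s \<in> nodes Ms \<Longrightarrow> \<Phi> (artin_gen Ms s) = artin_lift Mb (longest Mb (band_nodes m n s))"
proof -
  have "\<exists>\<Phi>\<in>monoid_hom (Artin Ms) (Artin Mb). \<forall>u\<in>lists (nodes Ms).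
      \<Phi> (artin_class Ms u) = artin_class Mb (full_bands u)"
    by (rule hom_on_generators[of full_band]) (fact full_band_lists, fact full_bands_alternating)
  then obtain \<Phi> where \<Phi>: "\<Phi> \<in> monoid_hom (Artin Ms) (Artin Mb)"
    "\<And>u. u \<in> lists (nodes Ms) \<Longrightarrow> \<Phi> (artin_class Ms u) = artin_class Mb (full_bands u)"
    by blast
  have gen: "\<Phi> (artin_gen Ms s) = artin_lift Mb (longest Mb (band_nodes m n s))"
    if "s \<in> nodes Ms" for s
    using \<Phi>(2)[of "[s]"] that by (simp add: artin_gen_def artin_lift_longest_band)
  have "standard_hom Ms Mb \<Phi>"
    unfolding standard_hom_def
  proof (intro conjI ballI exI)
    fix s
    assume s: "s \<in> nodes Ms"
    show "band_nodes m n s \<subseteq> nodes Mb" by (rule band_nodes_sub[OF s])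
    then show "finite (parabolic Mb (band_nodes m n s))" by (rule big.finite_parabolic)
    show "\<Phi> (artin_gen Ms s) = artin_lift Mb (longest Mb (band_nodes m n s))" by (rule gen[OF s])
  qed (rule \<Phi>(1))
  then show thesis using gen by (rule that)
qed

end

section \<open>The instances in types A and B\<close>

lemma cabling_strands:
  assumes "0 < m" "0 < n"
  shows "cabling (strands n) n (n - 1) (strands (n * m)) m (n * m - 1)"
proof -
  \<comment> \<open>The chain of \<open>strands k\<close> ends at \<open>k - 1\<close>, so the bond
    of order 4 between \<open>k - 1\<close> and \<open>k\<close> does not occur and all entries
    agree with type B.\<close>
  have A: "sub_type_B (strands k) k (k - 1)" for k
    by unfold_locales (auto simp: type_A_def type_B_def doubleton_eq_iff)
  show ?thesis
    unfolding cabling_def cabling_axioms_def using A assms by auto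
qed

lemma cabling_type_B:
  assumes "0 < m"
  shows "cabling (type_B n) n n (type_B (m * n)) m (n * m)"
proof -
  have B: "sub_type_B (type_B k) k k" for k
    by unfold_locales (auto simp: type_B_def)
  show ?thesis
    unfolding cabling_def cabling_axioms_def using B[of n] B[of "n * m"] assms
    by (auto simp: mult.commute)
qed

lemma band_nodes_block:
  assumes "i \<in> {1..n - 1}"
  shows "band_nodes m n i = block m i"
proof -
  have "(i + 1) * m \<le> n * m" using assms by (intro mult_le_mono1) auto
  then have "(i + 1) * m - 1 \<le> n * m" by linarith
  then show ?thesis by (auto simp: band_nodes_def block_def)
qed

lemma band_nodes_last:
  assumes "0 < m" "0 < n"
  shows "band_nodes m n n = {(n - 1) * m + 1..n * m}"
proof -
  have "n * m \<le> (n + 1) * m - 1" using assms by (simp add: algebra_simps)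
  then show ?thesis by (auto simp: band_nodes_def block_def)
qed

theorem theorem6p1:
  fixes m n :: nat
  assumes "m > 1" and "n > 0"
  shows
    "(\<exists>\<Phi>. coxeter_type_hom (strands n) (strands (n * m)) \<Phi> \<and>
        (\<forall>i\<in>{1..n - 1}. \<Phi> (artin_gen (strands n) i) =
           artin_lift (strands (n * m))
             (relative_longest (strands (n * m)) (block m i - {i * m}) (block m i))))
     \<and>
     (\<exists>\<Phi>. standard_hom (strands n) (strands (n * m)) \<Phi> \<and>
        (\<forall>i\<in>{1..n - 1}. \<Phi> (artin_gen (strands n) i) =
           artin_lift (strands (n * m)) (longest (strands (n * m)) (block m i))))
     \<and>
     (n \<ge> 2 \<longrightarrow>
       (\<exists>\<Phi>. coxeter_type_hom (type_B n) (type_B (m * n)) \<Phi> \<and>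
          (\<forall>i\<in>{1..n - 1}. \<Phi> (artin_gen (type_B n) i) =
             artin_lift (type_B (m * n))
               (relative_longest (type_B (m * n)) (block m i - {i * m}) (block m i))) \<and>
          \<Phi> (artin_gen (type_B n) n) =
             artin_lift (type_B (m * n))
               (relative_longest (type_B (m * n))
                 {(n - 1) * m + 1 .. n * m - 1} {(n - 1) * m + 1 .. n * m}))
       \<and>
       (\<exists>\<Phi>. standard_hom (type_B n) (type_B (m * n)) \<Phi> \<and>
          (\<forall>i\<in>{1..n - 1}. \<Phi> (artin_gen (type_B n) i) =
             artin_lift (type_B (m * n)) (longest (type_B (m * n)) (block m i))) \<and>
          \<Phi> (artin_gen (type_B n) n) =
             artin_lift (type_B (m * n))
               (longest (type_B (m * n)) {(n - 1) * m + 1 .. n * m})))"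
proof -
  have m: "0 < m" using assms by simp
  interpret A: cabling "strands n" n "n - 1" "strands (n * m)" m "n * m - 1"
    using cabling_strands m assms(2) .
  have nA: "nodes (strands n) = {1..n - 1}" by (simp add: type_A_def)
  have a: "\<exists>\<Phi>. coxeter_type_hom (strands n) (strands (n * m)) \<Phi> \<and>
        (\<forall>i\<in>{1..n - 1}. \<Phi> (artin_gen (strands n) i) =
           artin_lift (strands (n * m))
             (relative_longest (strands (n * m)) (block m i - {i * m}) (block m i)))"
    by (rule A.coxeter_type_cabling) (use band_nodes_block nA in auto)
  have b: "\<exists>\<Phi>. standard_hom (strands n) (strands (n * m)) \<Phi> \<and>
        (\<forall>i\<in>{1..n - 1}. \<Phi> (artin_gen (strands n) i) =
           artin_lift (strands (n * m)) (longest (strands (n * m)) (block m i)))"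
    by (rule A.standard_cabling) (use band_nodes_block nA in auto)
  interpret B: cabling "type_B n" n n "type_B (m * n)" m "n * m"
    using cabling_type_B m .
  have nB: "nodes (type_B n) = {1..n}" by (simp add: type_B_def)
  \<comment> \<open>For \<open>s = n\<close> the removed node \<open>s * m\<close> is the right end
    of the band.\<close>
  have last: "{(n - 1) * m + 1..n * m} - {n * m} = {(n - 1) * m + 1..n * m - 1}" by auto
  have n: "n \<in> nodes (type_B n)" using assms(2) by (simp add: nB)
  have c: "\<exists>\<Phi>. coxeter_type_hom (type_B n) (type_B (m * n)) \<Phi> \<and>
          (\<forall>i\<in>{1..n - 1}. \<Phi> (artin_gen (type_B n) i) =
             artin_lift (type_B (m * n))
               (relative_longest (type_B (m * n)) (block m i - {i * m}) (block m i))) \<and>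
          \<Phi> (artin_gen (type_B n) n) =
             artin_lift (type_B (m * n))
               (relative_longest (type_B (m * n))
                 {(n - 1) * m + 1 .. n * m - 1} {(n - 1) * m + 1 .. n * m})"
  proof (rule B.coxeter_type_cabling)
    fix \<Phi>
    assume \<Phi>: "coxeter_type_hom (type_B n) (type_B (m * n)) \<Phi>"
      "\<And>s. s \<in> nodes (type_B n) \<Longrightarrow> \<Phi> (artin_gen (type_B n) s) = artin_lift (type_B (m * n))
        (relative_longest (type_B (m * n)) (band_nodes m n s - {s * m}) (band_nodes m n s))"
    have "\<Phi> (artin_gen (type_B n) i) = artin_lift (type_B (m * n))
        (relative_longest (type_B (m * n)) (block m i - {i * m}) (block m i))"
      if "i \<in> {1..n - 1}" for i
    proof -
      have "i \<in> nodes (type_B n)" using that by (auto simp: nB)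
      then show ?thesis using \<Phi>(2)[of i] by (simp only: band_nodes_block[OF that])
    qed
    moreover have "\<Phi> (artin_gen (type_B n) n) = artin_lift (type_B (m * n))
        (relative_longest (type_B (m * n)) {(n - 1) * m + 1 .. n * m - 1} {(n - 1) * m + 1 .. n * m})"
      using \<Phi>(2)[OF n] by (simp only: last band_nodes_last[OF m assms(2)])
    ultimately show ?thesis using \<Phi>(1) by blast
  qed
  have d: "\<exists>\<Phi>. standard_hom (type_B n) (type_B (m * n)) \<Phi> \<and>
          (\<forall>i\<in>{1..n - 1}. \<Phi> (artin_gen (type_B n) i) =
             artin_lift (type_B (m * n)) (longest (type_B (m * n)) (block m i))) \<and>
          \<Phi> (artin_gen (type_B n) n) =
             artin_lift (type_B (m * n))
               (longest (type_B (m * n)) {(n - 1) * m + 1 .. n * m})"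
  proof (rule B.standard_cabling)
    fix \<Phi>
    assume \<Phi>: "standard_hom (type_B n) (type_B (m * n)) \<Phi>"
      "\<And>s. s \<in> nodes (type_B n) \<Longrightarrow> \<Phi> (artin_gen (type_B n) s) =
        artin_lift (type_B (m * n)) (longest (type_B (m * n)) (band_nodes m n s))"
    have "\<Phi> (artin_gen (type_B n) i) =
        artin_lift (type_B (m * n)) (longest (type_B (m * n)) (block m i))"
      if "i \<in> {1..n - 1}" for i
    proof -
      have "i \<in> nodes (type_B n)" using that by (auto simp: nB)
      then show ?thesis using \<Phi>(2)[of i] by (simp only: band_nodes_block[OF that])
    qed
    moreover have "\<Phi> (artin_gen (type_B n) n) =
        artin_lift (type_B (m * n)) (longest (type_B (m * n)) {(n - 1) * m + 1 .. n * m})"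
      using \<Phi>(2)[OF n] by (simp only: band_nodes_last[OF m assms(2)])
    ultimately show ?thesis using \<Phi>(1) by blast
  qed
  show ?thesis using a b c d by blast
qed

end
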